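(* Let $k$ be an $F$-finite field of characteristic $p>0$ and let $a\ge 3$ be an integer. Let $Q$ be the quiver with three vertices $1,2,3$, all mutable, with exactly $a$ arrows $1\to2$, $a$ arrows $2\to 3$, $a$ arrows $3\to1$, and no other arrows, and let $\mathbf x=\{x_1,x_2,x_3\}$ be a cluster in $\mathcal F=k(x_1,x_2,x_3)$ with $x_i$ at vertex $i$. Then the cluster algebra $\mathcal A(Q,\mathbf x)$ is not strongly $F$-regular.
   Context: Cluster algebras. Let $k$ be a field and $\mathcal F$ a purely transcendental extension of $k$ of finite transcendence degree $n$. A seed $(Q,\mathbf x)$ for $\mathcal F$ over $k$ consists of: a finite quiver $Q$ with vertices $1,\dots,n$, without loops or directed 2-cycles (multiple arrows allowed); a cluster $\mathbf x=\{x_1,\dots,x_n\}$ of algebraically independent elements with $\mathcal F=k(x_1,\dots,x_n)$, where $x_i$ is the cluster variable at vertex $i$; and a subset of vertices designated frozen, the other vertices being mutable, with the convention that every vertex touching no arrow is frozen. Mutation of the seed at a mutable vertex $\ell$ gives a new seed: the quiver is changed by (1) adding an arrow $i\to j$ for each pair of arrows $i\to \ell\to j$, (2) reversing all arrows incident to $\ell$, (3) cancelling directed 2-cycles in pairs; all cluster variables stay the same except $x_\ell$, which is replaced by $x_\ell'=\big(\prod_{i\to \ell}x_i+\prod_{\ell\to i}x_i\big)x_\ell^{-1}$ (products over all arrows into, resp. out of, $\ell$); frozen vertices stay frozen. Seeds are mutation-equivalent if related by a sequence of mutations. The cluster algebra $\mathcal A(Q,\mathbf x)$ is the $k$-subalgebra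 of $\mathcal F$ generated by all cluster variables of all seeds mutation-equivalent to $(Q,\mathbf x)$ and the inverses of the frozen variables. Frobenius notions. For a domain $R$ of characteristic $p>0$, $R^{1/p^e}\supseteq R$ is the ring of $p^e$-th roots of elements of $R$ in an algebraic closure of the fraction field of $R$. Here a domain $R$ is called strongly $F$-regular if for every nonzero $x\in R$ there exist $e\in\mathbb N$ and $\psi\in \operatorname{Hom}_R(R^{1/p^e},R)$ with $\psi(x^{1/p^e})=1$. A field $k$ of characteristic $p$ is $F$-finite if $k^{1/p}$ is a finite-dimensional $k$-vector space. *)

theory Defs
  imports "HOL-Algebra.Algebraic_Closure_Type" "HOL-Library.Poly_Mapping" "HOL.Hull"
begin

section \<open>Extensions of a field \<open>k\<close>\<close>

text \<open>
  The base field is a type \<open>'k\<close>, the extension field a type \<open>'f\<close>, and the extension is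
  given by a field homomorphism \<open>\<iota>\<close> from \<open>'k\<close> to \<open>'f\<close>.
\<close>

definition is_field_hom :: "('k::field \<Rightarrow> 'f::field) \<Rightarrow> bool" where
  "is_field_hom \<iota> \<longleftrightarrow>
     \<iota> 1 = 1 \<and> (\<forall>a b. \<iota> (a + b) = \<iota> a + \<iota> b) \<and> (\<forall>a b. \<iota> (a * b) = \<iota> a * \<iota> b)"

definition is_subalgebra :: "('k::field \<Rightarrow> 'f::field) \<Rightarrow> 'f set \<Rightarrow> bool" where
  "is_subalgebra \<iota> A \<longleftrightarrow>
     range \<iota> \<subseteq> A \<and> (\<forall>a\<in>A. - a \<in> A) \<and> (\<forall>a\<in>A. \<forall>b\<in>A. a + b \<in> A \<and> a * b \<in> A)"

definition is_intermediate_field :: "('k::field \<Rightarrow> 'f::field) \<Rightarrow> 'f set \<Rightarrow> bool" where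
  "is_intermediate_field \<iota> L \<longleftrightarrow> is_subalgebra \<iota> L \<and> (\<forall>a\<in>L. inverse a \<in> L)"

text \<open>
  A polynomial over \<open>'k\<close> in variables indexed by \<open>nat\<close> is a finitely supported map from
  exponent vectors (themselves finitely supported) to coefficients.
\<close>

definition eval_mpoly ::
    "('k::field \<Rightarrow> 'f::field) \<Rightarrow> (nat \<Rightarrow> 'f) \<Rightarrow> ((nat \<Rightarrow>\<^sub>0 nat) \<Rightarrow>\<^sub>0 'k) \<Rightarrow> 'f" where
  "eval_mpoly \<iota> x P =
     (\<Sum>m\<in>Poly_Mapping.keys P. \<iota> (Poly_Mapping.lookup P m) *
        (\<Prod>i\<in>Poly_Mapping.keys m. x i ^ Poly_Mapping.lookup m i))"

definition alg_independent ::
    "('k::field \<Rightarrow> 'f::field) \<Rightarrow> nat set \<Rightarrow> (nat \<Rightarrow> 'f) \<Rightarrow> bool" where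
  "alg_independent \<iota> I x \<longleftrightarrow>
     (\<forall>P. (\<forall>m\<in>Poly_Mapping.keys P. Poly_Mapping.keys m \<subseteq> I) \<longrightarrow>
          eval_mpoly \<iota> x P = 0 \<longrightarrow> P = 0)"

definition is_cluster :: "('k::field \<Rightarrow> 'f::field) \<Rightarrow> nat \<Rightarrow> (nat \<Rightarrow> 'f) \<Rightarrow> bool" where
  "is_cluster \<iota> n x \<longleftrightarrow>
     alg_independent \<iota> {1..n} x \<and> is_intermediate_field \<iota> hull (x ` {1..n}) = UNIV"


section \<open>Seeds, mutation and cluster algebras\<close>

text \<open>
  The vertices are \<open>{1..rank S}\<close>, and \<open>arrows S i j\<close> is the number of arrows from \<open>i\<close> to \<open>j\<close>.
  Values of \<open>cluster_var S\<close> outside \<open>{1..rank S}\<close> are irrelevant.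
\<close>

record 'f seed =
  rank :: nat
  arrows :: "nat \<Rightarrow> nat \<Rightarrow> nat"
  cluster_var :: "nat \<Rightarrow> 'f"
  frozen :: "nat set"

definition is_quiver :: "nat \<Rightarrow> (nat \<Rightarrow> nat \<Rightarrow> nat) \<Rightarrow> bool" where
  "is_quiver n q \<longleftrightarrow>
     (\<forall>i j. q i j > 0 \<longrightarrow> i \<in> {1..n} \<and> j \<in> {1..n}) \<and>
     (\<forall>i. q i i = 0) \<and>
     (\<forall>i j. q i j = 0 \<or> q j i = 0)"

definition is_seed :: "('k::field \<Rightarrow> 'f::field) \<Rightarrow> 'f seed \<Rightarrow> bool" where
  "is_seed \<iota> S \<longleftrightarrow>
     is_quiver (rank S) (arrows S) \<and>
     is_cluster \<iota> (rank S) (cluster_var S) \<and>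
     frozen S \<subseteq> {1..rank S} \<and>
     (\<forall>i\<in>{1..rank S}. (\<forall>j. arrows S i j = 0 \<and> arrows S j i = 0) \<longrightarrow> i \<in> frozen S)"

definition mutable :: "'f seed \<Rightarrow> nat set" where
  "mutable S = {1..rank S} - frozen S"

text \<open>
  The last step relies on truncated subtraction: cancelling 2-cycles between \<open>i\<close> and \<open>j\<close>
  in pairs leaves \<open>q i j - q j i\<close> arrows from \<open>i\<close> to \<open>j\<close>.
\<close>

definition mutate_quiver :: "nat \<Rightarrow> (nat \<Rightarrow> nat \<Rightarrow> nat) \<Rightarrow> nat \<Rightarrow> nat \<Rightarrow> nat" where
  "mutate_quiver l q =
     (let q1 = (\<lambda>i j. q i j + q i l * q l j);
          q2 = (\<lambda>i j. if i = l \<or> j = l then q1 j i else q1 i j)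
      in (\<lambda>i j. q2 i j - q2 j i))"

definition mutate :: "nat \<Rightarrow> 'f::field seed \<Rightarrow> 'f seed" where
  "mutate l S = S\<lparr>
     arrows := mutate_quiver l (arrows S),
     cluster_var := (cluster_var S)(l :=
       ((\<Prod>i\<in>{1..rank S}. cluster_var S i ^ arrows S i l) +
        (\<Prod>i\<in>{1..rank S}. cluster_var S i ^ arrows S l i)) * inverse (cluster_var S l))\<rparr>"

inductive mutation_equivalent :: "'f::field seed \<Rightarrow> 'f seed \<Rightarrow> bool" for S where
  refl: "mutation_equivalent S S"
| step: "mutation_equivalent S T \<Longrightarrow> l \<in> mutable T \<Longrightarrow> mutation_equivalent S (mutate l T)"

definition cluster_algebra :: "('k::field \<Rightarrow> 'f::field) \<Rightarrow> 'f seed \<Rightarrow> 'f set" where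
  "cluster_algebra \<iota> S = is_subalgebra \<iota> hull
     ((\<Union>T\<in>{T. mutation_equivalent S T}. cluster_var T ` {1..rank T}) \<union>
      (\<lambda>i. inverse (cluster_var S i)) ` frozen S)"

lemma is_subalgebra_cluster_algebra: "is_subalgebra \<iota> (cluster_algebra \<iota> S)"
  unfolding cluster_algebra_def
proof (rule hull_in)
  fix \<T> assume "\<forall>A\<in>\<T>. is_subalgebra \<iota> A"
  hence "range \<iota> \<subseteq> A" "a \<in> A \<Longrightarrow> - a \<in> A"
      "a \<in> A \<Longrightarrow> b \<in> A \<Longrightarrow> a + b \<in> A" "a \<in> A \<Longrightarrow> b \<in> A \<Longrightarrow> a * b \<in> A"
      if "A \<in> \<T>" for A a b
    using that by (simp_all add: is_subalgebra_def)
  thus "is_subalgebra \<iota> (\<Inter>\<T>)"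
    unfolding is_subalgebra_def by (simp add: Inter_greatest)
qed


section \<open>Frobenius notions\<close>

text \<open>
  For a subring \<open>R\<close> of a field \<open>'a\<close> of characteristic \<open>p > 0\<close>, this is \<open>R^(1/p^e)\<close>. The roots are taken
  in the algebraic closure of \<open>'a\<close>. They are algebraic over the fraction field of \<open>R\<close> inside \<open>'a\<close>,
  so they lie in its algebraic closure as well.
\<close>

definition frobenius_roots :: "nat \<Rightarrow> 'a::field set \<Rightarrow> 'a alg_closure set" where
  "frobenius_roots e R = {y. y ^ (CHAR('a) ^ e) \<in> to_ac ` R}"

definition is_root_hom :: "nat \<Rightarrow> 'a::field set \<Rightarrow> ('a alg_closure \<Rightarrow> 'a) \<Rightarrow> bool" where
  "is_root_hom e R \<psi> \<longleftrightarrow>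
     (\<forall>y\<in>frobenius_roots e R. \<psi> y \<in> R) \<and>
     (\<forall>y\<in>frobenius_roots e R. \<forall>z\<in>frobenius_roots e R. \<psi> (y + z) = \<psi> y + \<psi> z) \<and>
     (\<forall>r\<in>R. \<forall>y\<in>frobenius_roots e R. \<psi> (to_ac r * y) = r * \<psi> y)"

text \<open>
  Meaningful for subrings \<open>R\<close> of a field of positive characteristic, where the root \<open>y\<close> of \<open>x\<close> is
  unique.
\<close>

definition strongly_F_regular :: "'a::field set \<Rightarrow> bool" where
  "strongly_F_regular R \<longleftrightarrow>
     (\<forall>x\<in>R. x \<noteq> 0 \<longrightarrow>
       (\<exists>e \<psi> y. is_root_hom e R \<psi> \<and> y ^ (CHAR('a) ^ e) = to_ac x \<and> \<psi> y = 1))"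

definition F_finite :: "'k::field itself \<Rightarrow> bool" where
  "F_finite _ \<longleftrightarrow>
     (\<exists>B. finite B \<and>
       frobenius_roots 1 (UNIV :: 'k set) = module.span (\<lambda>c v. to_ac c * v) B)"


section \<open>The cyclic quiver on three vertices\<close>

definition cyclic_quiver :: "nat \<Rightarrow> nat \<Rightarrow> nat \<Rightarrow> nat" where
  "cyclic_quiver a i j = (if (i, j) \<in> {(1, 2), (2, 3), (3, 1)} then a else 0)"

definition cyclic_seed :: "nat \<Rightarrow> (nat \<Rightarrow> 'f) \<Rightarrow> 'f seed" where
  "cyclic_seed a x = \<lparr>rank = 3, arrows = cyclic_quiver a, cluster_var = x, frozen = {}\<rparr>"

lemma is_seed_cyclic_seed_iff:
  assumes "a > 0"
  shows "is_seed \<iota> (cyclic_seed a x) \<longleftrightarrow> is_cluster \<iota> 3 x"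
proof -
  have "is_quiver 3 (cyclic_quiver a)"
    by (auto simp: is_quiver_def cyclic_quiver_def split: if_splits)
  moreover have "\<exists>j. cyclic_quiver a i j \<noteq> 0" if "i \<in> {1..3}" for i
  proof -
    have "i = 1 \<or> i = 2 \<or> i = 3" using that by auto
    thus ?thesis using assms by (auto simp: cyclic_quiver_def)
  qed
  moreover have "\<not> (\<forall>j. cyclic_quiver a i j = 0 \<and> cyclic_quiver a j i = 0)"
    if "i \<in> {1..3}" for i
    using calculation(2)[OF that] by metis
  ultimately show ?thesis
    by (simp add: is_seed_def cyclic_seed_def)
qed

end

theory Submission
  imports Defs
begin

text \<open>
  Write \<open>x, y, z\<close> for the initial cluster. By the argument of Berenstein, Fomin and Zelevinsky, the cluster
  algebra \<open>A\<close> lies in the upper bound \<open>U\<close>, the intersection of the Laurent rings of the initial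
  seed and of its three neighbours. All quivers reached are cyclic: if the positive arrow numbers
  satisfy \<open>l\<^sup>2 + m\<^sup>2 + n\<^sup>2 \<le> l m n\<close>, then so do \<open>m n - l, m, n\<close>, and \<open>m n - l\<close> is positive.

  Put \<open>M = (x^a + y^a + z^a) / (x y z)\<close>. Then \<open>x y M\<close>, \<open>x z M\<close>, \<open>y z M\<close> lie in \<open>A\<close>. In
  \<open>k[x, y, z, M]\<close> the relation \<open>z^a = x y z M - x^a - y^a\<close> gives, for \<open>a \<ge> 3\<close> and all \<open>q\<close>, that
  \<open>z^a (z^(a-1))^q\<close> is in the ideal \<open>(x^q, y^q)\<close>. If \<open>A\<close> were strongly \<open>F\<close>-regular, a map
  sending \<open>(z^a)^(1/q)\<close> to \<open>1\<close> would turn this into \<open>z^(a-1) = x g + y h\<close> with \<open>g, h\<close> in the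
  localisations of \<open>A\<close> at \<open>x y\<close>, \<open>x z\<close>, \<open>y z\<close>, hence in \<open>U\<close>. Reduction modulo \<open>x^a + y^a + z^a\<close>
  and comparison of coefficients of \<open>z^(a-1)\<close> then yield \<open>1 = x r + y s\<close> with \<open>r\<close> in \<open>k[x, y, y\<^sup>-\<^sup>1]\<close> and
  \<open>s\<close> in \<open>k[x, x\<^sup>-\<^sup>1, y]\<close>, which is impossible.
\<close>

section \<open>Subalgebras and transcendence\<close>

locale field_extension =
  fixes \<iota> :: "'k::field \<Rightarrow> 'f::field"
  assumes hom: "is_field_hom \<iota>"
begin

lemma emb_0: "\<iota> 0 = 0"
proof -
  have "\<iota> 0 + \<iota> 0 = \<iota> 0 + 0"
    using hom unfolding is_field_hom_def by (metis add.right_neutral)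
  thus ?thesis by (simp only: add_left_cancel)
qed

lemma emb_1: "\<iota> 1 = 1"
  using hom by (simp add: is_field_hom_def)

lemma emb_add: "\<iota> (a + b) = \<iota> a + \<iota> b"
  using hom by (simp add: is_field_hom_def)

lemma emb_mult: "\<iota> (a * b) = \<iota> a * \<iota> b"
  using hom by (simp add: is_field_hom_def)

lemma emb_uminus: "\<iota> (- a) = - \<iota> a"
proof -
  have "\<iota> (- a) + \<iota> a = 0" by (simp flip: emb_add add: emb_0)
  thus ?thesis by (simp add: eq_neg_iff_add_eq_0)
qed

lemma emb_eq_0_iff: "\<iota> a = 0 \<longleftrightarrow> a = 0"
proof
  assume "\<iota> a = 0"
  hence "\<iota> (a * inverse a) = 0" by (simp add: emb_mult)
  thus "a = 0" using emb_1 by (cases "a = 0") auto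
qed (simp add: emb_0)

lemma emb_of_nat: "\<iota> (of_nat n) = of_nat n"
  by (induction n) (simp_all add: emb_0 emb_1 emb_add)

lemma CHAR_extension: "CHAR('f) = CHAR('k)"
proof (rule CHAR_eqI)
  show "of_nat CHAR('k) = (0 :: 'f)"
    by (metis emb_0 emb_of_nat of_nat_CHAR)
  show "CHAR('k) dvd n" if "of_nat n = (0 :: 'f)" for n
    using that by (metis emb_eq_0_iff emb_of_nat of_nat_eq_0_iff_char_dvd)
qed

definition alg :: "'f set \<Rightarrow> 'f set" where
  "alg G = is_subalgebra \<iota> hull G"

lemma is_subalgebra_alg: "is_subalgebra \<iota> (alg G)"
  unfolding alg_def
proof (rule hull_in)
  fix T assume "\<forall>A\<in>T. is_subalgebra \<iota> A"
  thus "is_subalgebra \<iota> (\<Inter>T)"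
    unfolding is_subalgebra_def by (simp add: Inter_greatest)
qed

lemma alg_minimal: "G \<subseteq> A \<Longrightarrow> is_subalgebra \<iota> A \<Longrightarrow> alg G \<subseteq> A"
  unfolding alg_def by (rule hull_minimal)

lemma alg_superset: "G \<subseteq> alg G"
  unfolding alg_def by (rule hull_subset)

lemma alg_least: "G \<subseteq> alg H \<Longrightarrow> alg G \<subseteq> alg H"
  by (rule alg_minimal[OF _ is_subalgebra_alg])

lemma alg_mono: "G \<subseteq> H \<Longrightarrow> alg G \<subseteq> alg H"
  using alg_least alg_superset by blast

lemma alg_incl: "x \<in> G \<Longrightarrow> x \<in> alg G"
  using alg_superset by blast

context
  fixes A assumes A: "is_subalgebra \<iota> A"
begin

lemma subalgebra_emb: "\<iota> c \<in> A"
  using A by (auto simp: is_subalgebra_def)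

lemma subalgebra_0: "0 \<in> A"
  using subalgebra_emb[of 0] by (simp add: emb_0)

lemma subalgebra_1: "1 \<in> A"
  using subalgebra_emb[of 1] by (simp add: emb_1)

lemma subalgebra_add: "f \<in> A \<Longrightarrow> g \<in> A \<Longrightarrow> f + g \<in> A"
  using A by (auto simp: is_subalgebra_def)

lemma subalgebra_mult: "f \<in> A \<Longrightarrow> g \<in> A \<Longrightarrow> f * g \<in> A"
  using A by (auto simp: is_subalgebra_def)

lemma subalgebra_uminus: "f \<in> A \<Longrightarrow> - f \<in> A"
  using A by (auto simp: is_subalgebra_def)

lemma subalgebra_diff: "f \<in> A \<Longrightarrow> g \<in> A \<Longrightarrow> f - g \<in> A"
  using subalgebra_add[of f "- g"] subalgebra_uminus by simp

lemma subalgebra_power: "f \<in> A \<Longrightarrow> f ^ n \<in> A"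
  by (induction n) (auto intro: subalgebra_mult subalgebra_1)

lemma subalgebra_sum: "(\<And>i. i \<in> I \<Longrightarrow> h i \<in> A) \<Longrightarrow> sum h I \<in> A"
  by (induction I rule: infinite_finite_induct) (auto intro: subalgebra_add subalgebra_0)

lemmas subalgebra_closed =
  subalgebra_emb subalgebra_0 subalgebra_1 subalgebra_add subalgebra_mult subalgebra_uminus
  subalgebra_diff subalgebra_power subalgebra_sum

end

lemmas alg_closed [intro] = subalgebra_closed[OF is_subalgebra_alg]

section \<open>Polynomials with coefficients in a subalgebra\<close>

definition polys :: "'f set \<Rightarrow> 'f poly set" where
  "polys A = {p. \<forall>i. coeff p i \<in> A}"

lemma polysI: "(\<And>i. coeff p i \<in> A) \<Longrightarrow> p \<in> polys A"
  by (simp add: polys_def)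

lemma polysD: "p \<in> polys A \<Longrightarrow> coeff p i \<in> A"
  by (simp add: polys_def)

lemma polys_mono: "A \<subseteq> B \<Longrightarrow> polys A \<subseteq> polys B"
  by (auto simp: polys_def)

context
  fixes A assumes A: "is_subalgebra \<iota> A"
begin

lemma polys_0: "0 \<in> polys A"
  by (simp add: polys_def subalgebra_0[OF A])

lemma polys_monom: "c \<in> A \<Longrightarrow> monom c n \<in> polys A"
  by (auto simp: polys_def subalgebra_closed[OF A])

lemma polys_add: "p \<in> polys A \<Longrightarrow> r \<in> polys A \<Longrightarrow> p + r \<in> polys A"
  by (auto simp: polys_def subalgebra_closed[OF A])

lemma polys_uminus: "p \<in> polys A \<Longrightarrow> - p \<in> polys A"
  by (auto simp: polys_def subalgebra_closed[OF A])

lemma polys_diff: "p \<in> polys A \<Longrightarrow> r \<in> polys A \<Longrightarrow> p - r \<in> polys A"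
  by (auto simp: polys_def subalgebra_closed[OF A])

lemma polys_smult: "c \<in> A \<Longrightarrow> p \<in> polys A \<Longrightarrow> smult c p \<in> polys A"
  by (auto simp: polys_def subalgebra_closed[OF A])

lemma polys_mult: "p \<in> polys A \<Longrightarrow> r \<in> polys A \<Longrightarrow> p * r \<in> polys A"
  by (auto simp: polys_def coeff_mult intro!: subalgebra_sum[OF A] subalgebra_mult[OF A])

lemma polys_sum: "(\<And>i. i \<in> I \<Longrightarrow> h i \<in> polys A) \<Longrightarrow> sum h I \<in> polys A"
  by (induction I rule: infinite_finite_induct) (auto intro: polys_add polys_0)

lemma poly_in_subalgebra: "p \<in> polys A \<Longrightarrow> t \<in> A \<Longrightarrow> poly p t \<in> A"
  unfolding poly_altdef by (intro subalgebra_closed[OF A]) (auto dest: polysD)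

lemmas polys_closed = polys_0 polys_monom polys_add polys_uminus polys_diff polys_smult polys_mult
  polys_sum

end

text \<open>The values at \<open>t\<close> of polynomials over \<open>alg G\<close> already form a
  subalgebra containing \<open>t\<close> and \<open>G\<close>, so minimality of the hull
  applies.\<close>

lemma alg_insert_poly:
  assumes "f \<in> alg (insert t G)"
  obtains p where "p \<in> polys (alg G)" "f = poly p t"
proof -
  let ?S = "(\<lambda>p. poly p t) ` polys (alg G)"
  have const: "c \<in> ?S" if "c \<in> alg G" for c
    using that
    by (intro image_eqI[where x = "monom c 0"])
       (auto simp: poly_monom intro: polys_monom is_subalgebra_alg)
  have "t \<in> ?S"
    by (intro image_eqI[where x = "monom 1 1"]) (auto simp: poly_monom intro: polys_monom is_subalgebra_alg)
  moreover have "is_subalgebra \<iota> ?S"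
    unfolding is_subalgebra_def
  proof safe
    show "\<iota> c \<in> ?S" for c using const by blast
  next
    fix p assume "p \<in> polys (alg G)"
    thus "- poly p t \<in> ?S"
      by (intro image_eqI[where x = "- p"]) (auto intro: polys_uminus is_subalgebra_alg)
  next
    fix p r assume "p \<in> polys (alg G)" "r \<in> polys (alg G)"
    hence "p + r \<in> polys (alg G)" "p * r \<in> polys (alg G)"
      by (auto intro: polys_add polys_mult is_subalgebra_alg)
    thus "poly p t + poly r t \<in> ?S" "poly p t * poly r t \<in> ?S"
      by (force simp flip: poly_add poly_mult)+
  qed
  ultimately have "alg (insert t G) \<subseteq> ?S"
    using const alg_superset by (intro alg_minimal) auto
  thus ?thesis using assms that by blast
qed

lemma poly_in_alg_insert: "p \<in> polys (alg G) \<Longrightarrow> poly p t \<in> alg (insert t G)"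
  using polys_mono[OF alg_mono[of G "insert t G"]]
  by (intro poly_in_subalgebra is_subalgebra_alg) (auto intro: alg_incl)

lemma alg_empty: "alg {} = range \<iota>"
proof
  have "is_subalgebra \<iota> (range \<iota>)"
    by (auto simp: is_subalgebra_def simp flip: emb_add emb_mult emb_uminus)
  thus "alg {} \<subseteq> range \<iota>" by (intro alg_minimal) auto
qed auto

section \<open>Clearing denominators in localisations\<close>

text \<open>Exponents add under sums and products. In this form, denominators in a generated algebra
  can be cleared by looking at its generators only.\<close>

lemma is_subalgebra_clearing:
  assumes A: "is_subalgebra \<iota> A" and t: "t \<in> A"
  shows "is_subalgebra \<iota> {f. \<exists>n. t ^ n * f \<in> A}"
  unfolding is_subalgebra_def
proof safe
  note closed = subalgebra_closed[OF A]
  show "\<exists>n. t ^ n * \<iota> c \<in> A" for c using closed(1) t by (intro exI[of _ 0]) simp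
  show "\<exists>n. t ^ n * - f \<in> A" if "t ^ m * f \<in> A" for f m
    using that closed(6) by (intro exI[of _ m]) fastforce
  fix f g m n assume f: "t ^ m * f \<in> A" and g: "t ^ n * g \<in> A"
  have "t ^ (m + n) * (f + g) = t ^ n * (t ^ m * f) + t ^ m * (t ^ n * g)"
    by (simp add: algebra_simps power_add)
  also have "\<dots> \<in> A" using f g t by (metis closed(4,5,8))
  finally show "\<exists>n. t ^ n * (f + g) \<in> A" ..
  have "t ^ (m + n) * (f * g) = (t ^ m * f) * (t ^ n * g)"
    by (simp add: algebra_simps power_add)
  also have "\<dots> \<in> A" using f g by (rule closed(5))
  finally show "\<exists>n. t ^ n * (f * g) \<in> A" ..
qed

lemma alg_clear_denominator:
  assumes "f \<in> alg (insert (inverse t) G)" "t \<in> alg G" "t \<noteq> 0"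
  obtains n where "t ^ n * f \<in> alg G"
proof -
  have "insert (inverse t) G \<subseteq> {f. \<exists>n. t ^ n * f \<in> alg G}"
  proof safe
    show "\<exists>n. t ^ n * inverse t \<in> alg G" using assms(3) by (intro exI[of _ 1]) auto
    show "\<exists>n. t ^ n * g \<in> alg G" if "g \<in> G" for g
      using that by (intro exI[of _ 0]) (auto intro: alg_incl)
  qed
  hence "alg (insert (inverse t) G) \<subseteq> {f. \<exists>n. t ^ n * f \<in> alg G}"
    by (intro alg_minimal is_subalgebra_clearing is_subalgebra_alg assms(2))
  thus ?thesis using assms(1) that by blast
qed

text \<open>The sum of the individual exponents works for all indices at once; this serves to clear
  all coefficients of a polynomial simultaneously.\<close>

lemma clear_denominators_family:
  assumes "\<And>i. i \<le> (d::nat) \<Longrightarrow> c i \<in> alg (insert (inverse t) G)" "t \<in> alg G" "t \<noteq> 0"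
  obtains n where "\<And>i. i \<le> d \<Longrightarrow> t ^ n * c i \<in> alg G"
proof -
  have "\<exists>n. t ^ n * c i \<in> alg G" if "i \<le> d" for i
    using alg_clear_denominator[OF assms(1)[OF that] assms(2,3)] by metis
  then obtain m where m: "t ^ m i * c i \<in> alg G" if "i \<le> d" for i by metis
  define n where "n = (\<Sum>i\<le>d. m i)"
  have "t ^ n * c i \<in> alg G" if "i \<le> d" for i
  proof -
    have "m i \<le> n" unfolding n_def using that by (intro member_le_sum) auto
    hence "t ^ n * c i = t ^ (n - m i) * (t ^ m i * c i)"
      by (simp add: power_add[symmetric] mult.assoc[symmetric])
    also have "\<dots> \<in> alg G" using m[OF that] assms(2) by (metis alg_closed(5,8))
    finally show ?thesis .
  qed
  thus ?thesis using that by blast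
qed

section \<open>Transcendence over a subalgebra: localisation, mutation, exchange of two
  elements\<close>

definition transcendental_over :: "'f set \<Rightarrow> 'f \<Rightarrow> bool" where
  "transcendental_over A t \<longleftrightarrow> (\<forall>p\<in>polys A. poly p t = 0 \<longrightarrow> p = 0)"

lemma transcendental_mono: "transcendental_over B t \<Longrightarrow> A \<subseteq> B \<Longrightarrow> transcendental_over A t"
  using polys_mono unfolding transcendental_over_def by blast

lemma transcendental_polys_eq:
  assumes "transcendental_over A t" "is_subalgebra \<iota> A" "p \<in> polys A" "r \<in> polys A"
    and "poly p t = poly r t"
  shows "p = r"
proof -
  have "p - r \<in> polys A" using assms by (intro polys_closed)
  moreover have "poly (p - r) t = 0" using assms(5) by simp
  ultimately have "p - r = 0" using assms(1) unfolding transcendental_over_def by blast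
  thus ?thesis by simp
qed

lemma transcendental_nonzero:
  assumes "transcendental_over A t" "is_subalgebra \<iota> A"
  shows "t \<noteq> 0"
proof
  assume "t = 0"
  hence "monom 1 1 = (0 :: 'f poly)"
    using assms polys_monom[OF assms(2) subalgebra_1[OF assms(2)], of 1]
    unfolding transcendental_over_def by (auto simp: poly_monom)
  thus False by (simp add: monom_eq_0_iff)
qed

lemma transcendental_power_add_nonzero:
  assumes t: "transcendental_over A t" and A: "is_subalgebra \<iota> A" and "u \<in> A" "b > 0"
  shows "t ^ b + u \<noteq> 0"
proof
  let ?p = "monom 1 b + monom u 0"
  assume "t ^ b + u = 0"
  moreover have "?p \<in> polys A" using assms by (intro polys_closed subalgebra_1)
  ultimately have "?p = 0" using t unfolding transcendental_over_def by (auto simp: poly_monom)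
  moreover have "coeff ?p b = 1" using \<open>b > 0\<close> by simp
  ultimately show False by simp
qed

text \<open>Multiplying a relation over the localisation by a high power of \<open>t\<close> gives a
  relation over \<open>alg G\<close> itself.\<close>

lemma transcendental_localise:
  assumes x: "transcendental_over (alg G) x" and "t \<in> alg G" "t \<noteq> 0"
  shows "transcendental_over (alg (insert (inverse t) G)) x"
  unfolding transcendental_over_def
proof safe
  fix p assume p: "p \<in> polys (alg (insert (inverse t) G))" and p0: "poly p x = 0"
  obtain n where n: "t ^ n * coeff p i \<in> alg G" if "i \<le> degree p" for i
    using clear_denominators_family[OF polysD[OF p] assms(2,3), of "degree p" "\<lambda>i. i"] by blast
  have "smult (t ^ n) p \<in> polys (alg G)"
  proof (rule polysI)
    fix i show "coeff (smult (t ^ n) p) i \<in> alg G"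
      using n[of i] by (cases "i \<le> degree p") (auto simp: coeff_eq_0)
  qed
  moreover have "poly (smult (t ^ n) p) x = 0" using p0 by simp
  ultimately show "p = 0" using x \<open>t \<noteq> 0\<close> unfolding transcendental_over_def by fastforce
qed

text \<open>A relation of degree \<open>d\<close> in \<open>c / x\<close>, multiplied by
  \<open>x ^ d\<close>, becomes a relation in \<open>x\<close> with reversed coefficients, each
  scaled by a power of the nonzero \<open>c\<close>.\<close>

lemma transcendental_mutate:
  assumes x: "transcendental_over (alg G) x" and c: "c \<in> alg G" "c \<noteq> 0"
  shows "transcendental_over (alg G) (c / x)"
  unfolding transcendental_over_def
proof safe
  note closed = polys_closed[OF is_subalgebra_alg]
  fix p assume p: "p \<in> polys (alg G)" and p0: "poly p (c / x) = 0"
  have x0: "x \<noteq> 0" by (rule transcendental_nonzero[OF x is_subalgebra_alg])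
  define d where "d = degree p"
  define r where "r = (\<Sum>i\<le>d. monom (coeff p i * c ^ i) (d - i))"
  have "r \<in> polys (alg G)"
    unfolding r_def using p c by (intro closed(8,2)) (auto dest: polysD)
  moreover have "poly r x = x ^ d * poly p (c / x)"
    unfolding r_def d_def poly_altdef[of p] sum_distrib_left
    by (auto simp: poly_sum poly_monom power_divide power_diff x0 intro!: sum.cong)
  ultimately have "r = 0" using x p0 unfolding transcendental_over_def by simp
  have "coeff r (d - i) = coeff p i * c ^ i" if "i \<le> d" for i
  proof -
    have "coeff r (d - i) = (\<Sum>j\<le>d. if j = i then coeff p i * c ^ i else 0)"
      unfolding r_def coeff_sum using that by (intro sum.cong) auto
    thus ?thesis using that by simp
  qed
  hence "coeff p i = 0" if "i \<le> d" for i using that \<open>r = 0\<close> c by fastforce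
  thus "p = 0" using d_def leading_coeff_0_iff by blast
qed

text \<open>A polynomial in \<open>y\<close> whose coefficients are polynomials in \<open>x\<close>
  is rewritten as a polynomial in \<open>x\<close> whose coefficients are polynomials in
  \<open>y\<close>. Transcendence of \<open>x\<close> kills these coefficients, and then
  transcendence of \<open>y\<close> kills theirs.\<close>

lemma transcendental_swap:
  assumes y: "transcendental_over (alg G) y" and x: "transcendental_over (alg (insert y G)) x"
  shows "transcendental_over (alg (insert x G)) y"
  unfolding transcendental_over_def
proof safe
  note closed = polys_closed[OF is_subalgebra_alg]
  fix p assume p: "p \<in> polys (alg (insert x G))" and p0: "poly p y = 0"
  have "\<exists>s. s \<in> polys (alg G) \<and> coeff p i = poly s x" for i
    using alg_insert_poly[OF polysD[OF p, of i]] by metis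
  then obtain s where s: "s i \<in> polys (alg G)" "coeff p i = poly (s i) x" for i by metis
  define d where "d = degree p"
  define r where "r = (\<Sum>i\<le>d. smult (y ^ i) (s i))"
  have G: "alg G \<subseteq> alg (insert y G)" by (rule alg_mono) auto
  have "r \<in> polys (alg (insert y G))"
    unfolding r_def using polys_mono[OF G] s(1) by (intro closed(8,6)) (auto intro: alg_incl)
  moreover have "poly r x = poly p y"
    unfolding r_def poly_altdef[of p] d_def by (simp add: poly_sum s(2) mult.commute)
  ultimately have "r = 0" using x p0 unfolding transcendental_over_def by simp
  have "coeff (s i) j = 0" if "i \<le> d" for i j
  proof -
    \<comment> \<open>\<open>w\<close> is the coefficient of \<open>x ^ j\<close> in the transposed
      polynomial, read as a polynomial in \<open>y\<close>.\<close>
    define w where "w = (\<Sum>i\<le>d. monom (coeff (s i) j) i)"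
    have "w \<in> polys (alg G)" unfolding w_def using s(1) by (intro closed(8,2)) (auto dest: polysD)
    moreover have "poly w y = coeff r j"
      unfolding w_def r_def by (simp add: poly_sum coeff_sum poly_monom mult.commute)
    ultimately have "w = 0" using y \<open>r = 0\<close> unfolding transcendental_over_def by simp
    moreover have "coeff w i = coeff (s i) j"
      unfolding w_def coeff_sum using that by simp
    ultimately show ?thesis by simp
  qed
  hence "s i = 0" if "i \<le> d" for i using that by (auto simp: poly_eq_iff)
  hence "coeff p i = 0" if "i \<le> d" for i using that s(2) by simp
  thus "p = 0" using d_def leading_coeff_0_iff by blast
qed

section \<open>Mutation in rank two\<close>

text \<open>Comparing the expansions of \<open>f\<close> in powers of \<open>x\<close> and of
  \<open>x'\<close> shows that the coefficient of \<open>1 / x ^ j\<close> is divisible by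
  \<open>c ^ j\<close>, and \<open>c ^ j / x ^ j = x' ^ j\<close>. The algebra \<open>alg G'\<close>
  may be larger than \<open>alg G\<close>, for instance with another variable inverted;
  \<open>cancel\<close> then brings the quotients back into \<open>alg G\<close>.\<close>

lemma mutation_intersection:
  assumes x: "transcendental_over (alg G') x" and G: "alg G \<subseteq> alg G'"
    and c: "c \<in> alg G" "c \<noteq> 0" and mut: "x * x' = c"
    and cancel: "\<And>s. s \<in> alg G' \<Longrightarrow> s * c \<in> alg G \<Longrightarrow> s \<in> alg G"
    and f: "f \<in> alg (insert (inverse x) (insert x G))" "f \<in> alg (insert (inverse x') (insert x' G'))"
  shows "f \<in> alg (insert x (insert x' G))"
proof -
  note closed = polys_closed[OF is_subalgebra_alg]
  have x0: "x \<noteq> 0" "x' \<noteq> 0" using mut c by auto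
  obtain n where "x ^ n * f \<in> alg (insert x G)"
    using alg_clear_denominator[OF f(1) alg_incl x0(1)] by blast
  then obtain P where P: "P \<in> polys (alg G)" "x ^ n * f = poly P x" by (rule alg_insert_poly)
  obtain m where "x' ^ m * f \<in> alg (insert x' G')"
    using alg_clear_denominator[OF f(2) alg_incl x0(2)] by blast
  then obtain Q where Q: "Q \<in> polys (alg G')" "x' ^ m * f = poly Q x'" by (rule alg_insert_poly)
  \<comment> \<open>\<open>l\<close> and \<open>r\<close> are two expressions for
    \<open>x ^ (n + m + d) * x' ^ m * f\<close>, one from \<open>P\<close> and one from
    \<open>Q\<close>. The factor \<open>x ^ (n + m + d)\<close> keeps all exponents natural after
    substituting \<open>x' = c / x\<close>.\<close>
  define d where "d = degree Q"
  define r where "r = (\<Sum>i\<le>d. monom (coeff Q i * c ^ i) (n + m + d - i))"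
  define l where "l = smult (c ^ m) (monom 1 d * P)"
  have c': "c \<in> alg G'" using c G by blast
  have P': "P \<in> polys (alg G')" using P polys_mono[OF G] by blast
  have "l = r"
  proof (rule transcendental_polys_eq[OF x is_subalgebra_alg])
    show "l \<in> polys (alg G')"
      unfolding l_def using c' P' by (intro closed(6,7,2) alg_closed)
    show "r \<in> polys (alg G')"
      unfolding r_def using c' Q(1) by (intro closed(8,2) alg_closed) (auto dest: polysD)
    have "poly l x = c ^ m * x ^ d * (x ^ n * f)"
      by (simp add: l_def P(2) poly_monom)
    also have "\<dots> = x ^ (n + m + d) * (x' ^ m * f)"
      by (simp add: power_add power_mult_distrib flip: mut)
    also have "\<dots> = (\<Sum>i\<le>d. coeff Q i * (x ^ (n + m + d) * x' ^ i))"
      unfolding Q(2) poly_altdef d_def sum_distrib_left by (intro sum.cong) simp_all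
    also have "\<dots> = (\<Sum>i\<le>d. coeff Q i * c ^ i * x ^ (n + m + d - i))"
    proof (rule sum.cong[OF HOL.refl])
      fix i assume "i \<in> {..d}"
      hence "x ^ (n + m + d) = x ^ i * x ^ (n + m + d - i)" by (simp flip: power_add)
      thus "coeff Q i * (x ^ (n + m + d) * x' ^ i) = coeff Q i * c ^ i * x ^ (n + m + d - i)"
        by (simp add: power_mult_distrib mult_ac flip: mut)
    qed
    also have "\<dots> = poly r x" by (simp add: r_def poly_sum poly_monom)
    finally show "poly l x = poly r x" .
  qed
  \<comment> \<open>This is the comparison at exponent \<open>k + d\<close>. In \<open>r\<close> it
    is reached only by \<open>i = n + m - k\<close>; if that exceeds \<open>d\<close>, the
    coefficient of \<open>Q\<close> is zero.\<close>
  have key: "coeff P k = coeff Q (n + m - k) * c ^ (n - k)" if "k < n" for k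
  proof -
    have "c ^ m * coeff P k = coeff l (k + d)" by (simp add: l_def coeff_monom_mult)
    also have "\<dots> = (\<Sum>i\<le>d. if i = n + m - k then coeff Q i * c ^ i else 0)"
      unfolding \<open>l = r\<close> r_def coeff_sum using that by (intro sum.cong) auto
    also have "\<dots> = coeff Q (n + m - k) * c ^ (n + m - k)"
      using coeff_eq_0[of Q "n + m - k"] by (auto simp: d_def)
    also have "c ^ (n + m - k) = c ^ m * c ^ (n - k)"
      using that by (simp add: add.commute flip: power_add)
    finally show ?thesis using c by simp
  qed
  have cancel': "s \<in> alg G" if "s \<in> alg G'" "s * c ^ i \<in> alg G" for s i
    using that
  proof (induction i)
    case (Suc i)
    have "s * c ^ i \<in> alg G'" using Suc.prems(1) c' by (intro alg_closed(5,8))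
    moreover have "s * c ^ i * c \<in> alg G" using Suc.prems(2) by (simp add: mult_ac)
    ultimately have "s * c ^ i \<in> alg G" by (rule cancel)
    thus ?case using Suc.IH Suc.prems(1) by blast
  qed simp
  have "f = (\<Sum>k\<le>degree P. coeff P k * (x ^ k / x ^ n))"
  proof -
    have "f = poly P x / x ^ n" using P(2) x0 by (simp add: field_simps)
    thus ?thesis by (simp add: poly_altdef sum_divide_distrib)
  qed
  also have "\<dots> \<in> alg (insert x (insert x' G))"
  proof (rule alg_closed(9))
    fix k
    have sub: "alg G \<subseteq> alg (insert x (insert x' G))" by (rule alg_mono) auto
    show "coeff P k * (x ^ k / x ^ n) \<in> alg (insert x (insert x' G))"
    proof (cases "k < n")
      case False
      hence "x ^ k / x ^ n = x ^ (k - n)" using x0 by (simp add: power_diff)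
      moreover have "coeff P k \<in> alg (insert x (insert x' G))" using polysD[OF P(1)] sub by blast
      ultimately show ?thesis by (auto intro: alg_incl)
    next
      case True
      have "coeff Q (n + m - k) \<in> alg G"
        using cancel'[of "coeff Q (n + m - k)" "n - k"] key[OF True] polysD[OF P(1), of k]
          polysD[OF Q(1)] by simp
      hence *: "coeff Q (n + m - k) \<in> alg (insert x (insert x' G))" using sub by blast
      have "x ^ n = x ^ k * x ^ (n - k)" using True by (simp flip: power_add)
      hence "coeff P k * (x ^ k / x ^ n) = coeff Q (n + m - k) * x' ^ (n - k)"
        using x0 by (simp add: key[OF True] power_mult_distrib flip: mut)
      thus ?thesis using * by (auto intro: alg_incl)
    qed
  qed
  finally show ?thesis .
qed

text \<open>Modulo \<open>y\<close> the factor \<open>y ^ b + u\<close> is the unit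
  \<open>u\<close>, so it cannot absorb a denominator \<open>y\<close>. This supplies the hypothesis
  \<open>cancel\<close> of \<open>mutation_intersection\<close> when \<open>G'\<close> inverts
  \<open>y\<close>.\<close>

lemma insert_inverse_power_add_cancel:
  assumes s: "s \<in> alg (insert (inverse y) (insert y G))" "s * (y ^ b + u) \<in> alg (insert y G)"
    and u: "u \<in> alg G" "inverse u \<in> alg G" "u \<noteq> 0" and b: "b > 0" and y: "y \<noteq> 0"
  shows "s \<in> alg (insert y G)"
proof -
  have G: "alg G \<subseteq> alg (insert y G)" by (rule alg_mono) auto
  have yG: "y ^ i \<in> alg (insert y G)" for i by (auto intro: alg_incl)
  obtain n where "y ^ n * s \<in> alg (insert y G)"
    using alg_clear_denominator[OF s(1) _ y] by (auto intro: alg_incl)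
  thus ?thesis
  proof (induction n)
    case (Suc n)
    \<comment> \<open>Solve \<open>y ^ n * (s * (y ^ b + u))\<close> for its \<open>u\<close> term;
      since \<open>b > 0\<close>, the other term contains \<open>y ^ Suc n * s\<close>. This lowers
      the exponent of the denominator by one.\<close>
    have "y ^ n * s = inverse u * (y ^ n * (s * (y ^ b + u)) - y ^ (b - 1) * (y ^ Suc n * s))"
      using b u(3) by (cases b) (auto simp: field_simps power_add)
    also have "\<dots> \<in> alg (insert y G)"
    proof -
      have "inverse u \<in> alg (insert y G)" using u G by blast
      thus ?thesis using Suc.prems s(2) yG by (metis alg_closed(5,7))
    qed
    finally show ?case by (rule Suc.IH)
  qed simp
qed

text \<open>
  The next two lemmas are the rank 2 part of the argument of Berenstein, Fomin and Zelevinsky for the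
  invariance of upper bounds under mutation; the third cluster variable and its inverse are
  in the coefficient algebra \<open>alg G\<close>.
\<close>

lemma rank2_upper_bound:
  assumes x: "transcendental_over (alg (insert (inverse y) (insert y G))) x"
    and y: "transcendental_over (alg (insert (inverse x) (insert x G))) y"
    and u: "u \<in> alg G" "inverse u \<in> alg G" "u \<noteq> 0"
    and v: "v \<in> alg G" and b: "b > 0"
    and mut: "x * x' = y ^ b + u" "y * y' = x ^ b + v"
    and f: "f \<in> alg ({x, inverse x, y, inverse y} \<union> G)"
      "f \<in> alg ({x', inverse x', y, inverse y} \<union> G)" "f \<in> alg ({x, inverse x, y', inverse y'} \<union> G)"
  shows "f \<in> alg ({x, x', y, y'} \<union> G)"
proof -
  have x0: "x \<noteq> 0" and y0: "y \<noteq> 0"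
    using transcendental_nonzero[OF x is_subalgebra_alg]
      transcendental_nonzero[OF y is_subalgebra_alg] by auto
  have Gx: "alg G \<subseteq> alg (insert (inverse x) (insert x G))" and
    Gy: "alg G \<subseteq> alg (insert (inverse y) (insert y G))" and Gy': "alg G \<subseteq> alg (insert y G)"
    by (intro alg_mono; auto)+
  have c0: "y ^ b + u \<noteq> 0"
    using transcendental_power_add_nonzero[OF y is_subalgebra_alg _ b] u(1) Gx by blast
  have d0: "x ^ b + v \<noteq> 0"
    using transcendental_power_add_nonzero[OF x is_subalgebra_alg _ b] v Gy by blast
  have x'0: "x' \<noteq> 0" using mut c0 by auto
  have x': "x' = (y ^ b + u) * inverse x" and y': "y' = (x ^ b + v) * inverse y"
    and xx': "x = (y ^ b + u) * inverse x'"
    using mut x0 y0 x'0 by (simp_all add: field_simps)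
  define D where "D = alg ({x, x', y, y'} \<union> G)"
  define D0 where "D0 = alg ({x, x', y} \<union> G)"
  define E where "E = alg ({x, inverse x, y} \<union> G)"
  have subalg: "is_subalgebra \<iota> D" "is_subalgebra \<iota> D0" "is_subalgebra \<iota> E"
    unfolding D_def D0_def E_def by (rule is_subalgebra_alg)+
  note Dc = subalgebra_closed[OF subalg(1)] and D0c = subalgebra_closed[OF subalg(2)]
    and Ec = subalgebra_closed[OF subalg(3)]
  have GE: "alg G \<subseteq> E" and GD0: "alg G \<subseteq> D0" and D0D: "D0 \<subseteq> D"
    unfolding E_def D0_def D_def by (intro alg_mono; auto)+
  have inE: "x \<in> E" "inverse x \<in> E" "y \<in> E" "u \<in> E" "inverse u \<in> E" "v \<in> E"
    using GE u v unfolding E_def by (auto intro: alg_incl)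
  have inD0: "x \<in> D0" "x' \<in> D0" "y \<in> D0" "u \<in> D0" "inverse u \<in> D0" "v \<in> D0"
    using GD0 u v unfolding D0_def by (auto intro: alg_incl)
  have y'D: "y' \<in> D" unfolding D_def by (auto intro: alg_incl)
  have "x' \<in> E" unfolding x' using inE by (intro Ec)
  hence D0E: "D0 \<subseteq> E" unfolding D0_def using inE GE alg_superset[of G]
    by (intro alg_minimal subalg) auto

  have perm: "{x, inverse x, y, inverse y} \<union> G = insert (inverse y) (insert y (insert (inverse x) (insert x G)))"
    "{x, inverse x, y', inverse y'} \<union> G = insert (inverse y') (insert y' (insert (inverse x) (insert x G)))"
    "{x', inverse x', y, inverse y} \<union> G = insert (inverse x') (insert x' (insert (inverse y) (insert y G)))"
    "{x, inverse x, y} \<union> G = insert (inverse x) (insert x (insert y G))"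
    "insert y' ({x, inverse x, y} \<union> G) = insert y (insert y' (insert (inverse x) (insert x G)))"
    "{x, x', y} \<union> G = insert x (insert x' (insert y G))"
    by blast+
  have f': "f \<in> alg (insert (inverse y) (insert y (insert (inverse x) (insert x G))))"
    "f \<in> alg (insert (inverse y') (insert y' (insert (inverse x) (insert x G))))"
    "f \<in> alg (insert (inverse x') (insert x' (insert (inverse y) (insert y G))))"
    using f by (simp_all only: perm)
  have *: "x ^ b + v \<in> alg (insert (inverse x) (insert x G))"
  proof -
    have "v \<in> alg (insert (inverse x) (insert x G))" "x \<in> alg (insert (inverse x) (insert x G))"
      using v Gx by (auto intro: alg_incl)
    thus ?thesis by (intro alg_closed(4,8))
  qed
  \<comment> \<open>First the exchange at \<open>y\<close> is treated with \<open>x\<close>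
    inverted. Both coefficient algebras coincide here, so the cancellation hypothesis is
    trivial.\<close>
  have "f \<in> alg (insert y (insert y' (insert (inverse x) (insert x G))))"
    by (rule mutation_intersection[OF y order.refl * d0 mut(2) _ f'(1) f'(2)])
  hence "f \<in> alg (insert y' ({x, inverse x, y} \<union> G))" unfolding perm(5) .
  then obtain p where p: "p \<in> polys E" "f = poly p y'" unfolding E_def by (rule alg_insert_poly)

  text \<open>Modulo \<open>y\<close>, the element \<open>u\<^sup>-\<^sup>1 x'\<close> is an inverse of \<open>x\<close>; hence \<open>E = D0 + y E\<close>.\<close>
  define W where "W = {d + y * e |d e. d \<in> D0 \<and> e \<in> E}"
  have "is_subalgebra \<iota> W"
    unfolding is_subalgebra_def
  proof safe
    show "\<iota> c \<in> W" for c unfolding W_def using D0c(1) Ec(2) by force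
    show "- w \<in> W" if w: "w \<in> W" for w
    proof -
      obtain d e where de: "d \<in> D0" "e \<in> E" "w = d + y * e" using w by (auto simp: W_def)
      have "- w = - d + y * (- e)" by (simp add: de)
      moreover have "- d \<in> D0" "- e \<in> E" by (rule D0c(6)[OF de(1)] Ec(6)[OF de(2)])+
      ultimately show ?thesis unfolding W_def by blast
    qed
    fix w w' assume "w \<in> W" "w' \<in> W"
    then obtain d e d' e' where de: "d \<in> D0" "e \<in> E" "w = d + y * e"
      "d' \<in> D0" "e' \<in> E" "w' = d' + y * e'" by (auto simp: W_def)
    have "w + w' = (d + d') + y * (e + e')" by (simp add: de algebra_simps)
    moreover have "d + d' \<in> D0" "e + e' \<in> E"
      by (rule D0c(4)[OF de(1,4)] Ec(4)[OF de(2,5)])+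
    ultimately show "w + w' \<in> W" unfolding W_def by blast
    have "w * w' = d * d' + y * (d * e' + e * d' + y * e * e')" by (simp add: de algebra_simps)
    moreover have "d \<in> E" "d' \<in> E" using de D0E by blast+
    hence "d * e' + e * d' + y * e * e' \<in> E" using de(2,5) inE(3) by (intro Ec(4,5))
    moreover have "d * d' \<in> D0" by (rule D0c(5)[OF de(1,4)])
    ultimately show "w * w' \<in> W" unfolding W_def by blast
  qed
  moreover have "{x, inverse x, y} \<union> G \<subseteq> W"
  proof -
    have D0W: "d \<in> W" if "d \<in> D0" for d unfolding W_def using that Ec(2) by force
    \<comment> \<open>Divide \<open>x * x' = y ^ b + u\<close> by \<open>u * x\<close>.\<close>
    have "inverse x = inverse u * x' + y * (- inverse u * y ^ (b - 1) * inverse x)"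
      using b u(3) x0 by (cases b) (auto simp: x' field_simps)
    moreover have "inverse u * x' \<in> D0" using inD0 by (intro D0c)
    moreover have "- inverse u * y ^ (b - 1) * inverse x \<in> E" using inE by (intro Ec)
    ultimately have "inverse x \<in> W" unfolding W_def by blast
    thus ?thesis using D0W inD0 alg_superset[of G] GD0 by auto
  qed
  ultimately have EW: "E \<subseteq> W" unfolding E_def by (intro alg_minimal) auto

  \<comment> \<open>With \<open>e = d + y * e'\<close>, the part \<open>d * y' ^ i\<close> lies in
    \<open>D\<close>, and in the rest \<open>y * y' = x ^ b + v\<close> removes one factor
    \<open>y'\<close>. Iterating pushes everything outside \<open>D\<close> into \<open>E\<close>,
    where \<open>y'\<close> no longer occurs.\<close>
  have split: "\<exists>d\<in>D. \<exists>e'\<in>E. e * y' ^ i = d + e'" if "e \<in> E" for e i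
    using that
  proof (induction i arbitrary: e)
    case 0
    thus ?case using Dc(2) by force
  next
    case (Suc i)
    obtain d e' where de: "d \<in> D0" "e' \<in> E" "e = d + y * e'"
      using Suc.prems EW unfolding W_def by blast
    have "e * y' ^ Suc i = d * y' ^ Suc i + (e' * (x ^ b + v)) * y' ^ i"
      unfolding de(3) mut(2)[symmetric] by (simp add: algebra_simps)
    moreover have "d \<in> D" using de D0D by blast
    hence "d * y' ^ Suc i \<in> D" using y'D by (intro Dc(5,8))
    moreover have "e' * (x ^ b + v) \<in> E" using de inE by (intro Ec(4,5,8))
    then obtain d1 e1 where "d1 \<in> D" "e1 \<in> E" "e' * (x ^ b + v) * y' ^ i = d1 + e1"
      using Suc.IH by blast
    ultimately show ?case using Dc(4)[of "d * y' ^ Suc i" d1] by (metis add.assoc)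
  qed
  have "\<exists>d\<in>D. \<exists>e'\<in>E. (\<Sum>i\<le>n. coeff p i * y' ^ i) = d + e'" for n
  proof (induction n)
    case 0
    show ?case using split[of "coeff p 0" 0] polysD[OF p(1)] by simp
  next
    case (Suc n)
    obtain d e where 1: "d \<in> D" "e \<in> E" "(\<Sum>i\<le>n. coeff p i * y' ^ i) = d + e" using Suc by blast
    obtain d' e' where 2: "d' \<in> D" "e' \<in> E" "coeff p (Suc n) * y' ^ Suc n = d' + e'"
      using split[of "coeff p (Suc n)" "Suc n"] polysD[OF p(1)] by blast
    have "(\<Sum>i\<le>Suc n. coeff p i * y' ^ i) = (d + d') + (e + e')"
      by (simp only: sum.atMost_Suc 1(3) 2(3) add_ac)
    moreover have "d + d' \<in> D" "e + e' \<in> E"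
      by (rule Dc(4)[OF 1(1) 2(1)] Ec(4)[OF 1(2) 2(2)])+
    ultimately show ?case by blast
  qed
  then obtain d e where de: "d \<in> D" "e \<in> E" "f = d + e"
    unfolding p(2) poly_altdef by blast

  \<comment> \<open>Since \<open>D\<close> lies in the Laurent ring at \<open>x'\<close>, so does
    the remainder \<open>e = f - d\<close>. Now the exchange at \<open>x\<close> can be treated for
    \<open>e\<close>, with \<open>y\<close> not inverted on the side of \<open>E\<close>.\<close>
  have "D \<subseteq> alg ({x', inverse x', y, inverse y} \<union> G)" (is "_ \<subseteq> ?L")
  proof -
    have GL: "alg G \<subseteq> ?L" by (rule alg_mono) auto
    have L: "x' \<in> ?L" "inverse x' \<in> ?L" "y \<in> ?L" "inverse y \<in> ?L" by (auto intro: alg_incl)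
    moreover have uv: "u \<in> ?L" "v \<in> ?L" using GL u v by blast+
    hence xL: "x \<in> ?L" using L by (subst xx') (intro alg_closed(4,5,8))
    moreover have "y' \<in> ?L" using L uv xL by (subst y') (intro alg_closed(4,5,8))
    ultimately show ?thesis unfolding D_def using alg_superset[of "{x', inverse x', y, inverse y} \<union> G"]
      by (intro alg_least) auto
  qed
  hence "f - d \<in> alg ({x', inverse x', y, inverse y} \<union> G)"
    using f(2) de(1) by (intro alg_closed(7)) blast+
  hence e: "e \<in> alg (insert (inverse x') (insert x' (insert (inverse y) (insert y G))))"
    using de(3) unfolding perm(3) by simp
  have "e \<in> alg (insert x (insert x' (insert y G)))"
  proof (rule mutation_intersection[OF x _ _ c0 mut(1) _ _ e])
    show "alg (insert y G) \<subseteq> alg (insert (inverse y) (insert y G))" by (rule alg_mono) auto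
    show "y ^ b + u \<in> alg (insert y G)"
    proof -
      have "u \<in> alg (insert y G)" "y \<in> alg (insert y G)" using u Gy' by (auto intro: alg_incl)
      thus ?thesis by (intro alg_closed(4,8))
    qed
    show "e \<in> alg (insert (inverse x) (insert x (insert y G)))"
      using de(2) unfolding E_def perm(4) .
    show "s \<in> alg (insert y G)"
      if "s \<in> alg (insert (inverse y) (insert y G))" "s * (y ^ b + u) \<in> alg (insert y G)" for s
      using insert_inverse_power_add_cancel[OF that u b y0] .
  qed
  hence "e \<in> D0" unfolding D0_def perm(6) .
  hence "d + e \<in> D" using de(1) D0D by (intro Dc(4)) blast+
  thus ?thesis unfolding D_def de(3) .
qed

lemma rank2_mutation:
  assumes nz: "x' \<noteq> 0" "y \<noteq> 0" "y'' \<noteq> 0" "u \<noteq> 0" "v \<noteq> 0"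
    and u: "u \<in> alg G" "inverse u \<in> alg G" and v: "v \<in> alg G" "inverse v \<in> alg G" and b: "b > 0"
    and mut: "x * x' = y ^ b + u" "y * y' = x ^ b + v" "y * y'' = x' ^ b + u ^ b / v"
  shows "alg ({x, x', y, y'} \<union> G) \<subseteq> alg ({x', inverse x', y'', inverse y''} \<union> G)" (is "_ \<subseteq> ?L")
proof -
  have GL: "alg G \<subseteq> ?L" by (rule alg_mono) auto
  have L: "x' \<in> ?L" "inverse x' \<in> ?L" "y'' \<in> ?L" "inverse y'' \<in> ?L"
      "u \<in> ?L" "inverse u \<in> ?L" "v \<in> ?L" "inverse v \<in> ?L"
    using GL u v by (auto intro: alg_incl)
  have "y = (x' ^ b + u ^ b * inverse v) * inverse y''"
    using mut(3) nz by (simp add: field_simps)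
  hence y: "y \<in> ?L" using L by (metis alg_closed(4,5,8))
  have "x = (y ^ b + u) * inverse x'" using mut(1) nz by (simp add: field_simps)
  hence x: "x \<in> ?L" using L y by (metis alg_closed(4,5,8))
  \<comment> \<open>\<open>s\<close> is the quotient of \<open>(y ^ b + u) ^ b - u ^ b\<close> by
    \<open>y ^ b\<close>. It allows a factor \<open>y\<close> to be cancelled from the formula for
    \<open>y * (x ^ b * y'')\<close>, which is then solved for \<open>y'\<close> as \<open>u\<close>
    and \<open>v\<close> are units.\<close>
  define s where "s = (\<Sum>i<b. u ^ (b - Suc i) * (y ^ b + u) ^ i)"
  have s: "(y ^ b + u) ^ b - u ^ b = y ^ b * s"
    unfolding s_def by (subst power_diff_sumr2) simp
  have "y * (x ^ b * y'') = x ^ b * (y * y'')" by simp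
  also have "\<dots> = (x * x') ^ b + x ^ b * (u ^ b / v)"
    unfolding mut(3) by (simp add: power_mult_distrib algebra_simps)
  also have "\<dots> = y ^ b * s + (u ^ b / v) * (y * y')"
    using s nz by (simp add: mut field_simps)
  also have "\<dots> = y * (y ^ (b - 1) * s + (u ^ b / v) * y')"
    using b by (cases b) (auto simp: algebra_simps)
  finally have "x ^ b * y'' = y ^ (b - 1) * s + (u ^ b / v) * y'" using nz by simp
  hence "y' = v * inverse u ^ b * (x ^ b * y'' - y ^ (b - 1) * s)"
    using nz by (simp add: field_simps)
  moreover have "s \<in> ?L" unfolding s_def using y L by (intro alg_closed(4,5,8,9)) auto
  ultimately have "y' \<in> ?L" using L x y by (metis alg_closed(5,7,8))
  thus ?thesis using x y L alg_superset[of "{x', inverse x', y'', inverse y''} \<union> G"]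
    by (intro alg_least) auto
qed

section \<open>Upper bounds of cyclic seeds\<close>

text \<open>Exponent triples correspond injectively to exponent vectors supported on the three
  labels, so the sum is the value of a \<open>Poly_Mapping\<close> polynomial whose coefficients are
  exactly the \<open>s i j k\<close>.\<close>

lemma alg_independent_sum_eq_0:
  assumes ind: "alg_independent \<iota> {1..3} x" and L: "distinct [l1, l2, l3]" "{l1, l2, l3} = {1..3}"
    and I: "finite I"
    and sum: "(\<Sum>(i, j, k)\<in>I. \<iota> (s i j k) * x l1 ^ i * x l2 ^ j * x l3 ^ k) = 0"
    and mem: "(i, j, k) \<in> I"
  shows "s i j k = 0"
proof -
  define mon where "mon = (\<lambda>(i, j, k). Poly_Mapping.single l1 i + Poly_Mapping.single l2 j
    + Poly_Mapping.single l3 k :: nat \<Rightarrow>\<^sub>0 nat)"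
  define coef where "coef = (\<lambda>(i, j, k). s i j k)"
  have mon_lookup: "Poly_Mapping.lookup (mon (i, j, k)) l =
      (if l = l1 then i else if l = l2 then j else if l = l3 then k else 0)" for i j k l
    using L(1) by (auto simp: mon_def lookup_add lookup_single)
  have inj: "inj_on mon I"
  proof (rule inj_onI)
    fix t t' assume eq: "mon t = mon t'"
    obtain i j k i' j' k' where t: "t = (i, j, k)" "t' = (i', j', k')" by (cases t, cases t') auto
    have "Poly_Mapping.lookup (mon t) l = Poly_Mapping.lookup (mon t') l" for l by (simp add: eq)
    from this[of l1] this[of l2] this[of l3] show "t = t'"
      using L(1) by (auto simp: t mon_lookup)
  qed
  define P where "P = (\<Sum>t\<in>I. Poly_Mapping.single (mon t) (coef t))"
  have P_lookup: "Poly_Mapping.lookup P (mon t) = coef t" if "t \<in> I" for t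
  proof -
    have "Poly_Mapping.lookup P (mon t) = (\<Sum>t'\<in>I. if t' = t then coef t else 0)"
      unfolding P_def lookup_sum
      using that inj by (intro sum.cong) (auto simp: lookup_single when_def dest: inj_onD)
    thus ?thesis using that I by simp
  qed
  have "Poly_Mapping.keys P \<subseteq> (\<Union>t\<in>I. Poly_Mapping.keys (Poly_Mapping.single (mon t) (coef t)))"
    unfolding P_def by (rule keys_sum)
  hence P_keys: "Poly_Mapping.keys P \<subseteq> mon ` I" by (auto split: if_splits)
  have mon_keys: "Poly_Mapping.keys (mon t) \<subseteq> {1..3}" for t
  proof
    fix l assume "l \<in> Poly_Mapping.keys (mon t)"
    hence "l \<in> {l1, l2, l3}" by (cases t) (auto simp: in_keys_iff mon_lookup split: if_splits)
    thus "l \<in> {1..3}" using L(2) by simp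
  qed
  define ev where "ev m = (\<Prod>i\<in>Poly_Mapping.keys m. x i ^ Poly_Mapping.lookup m i)" for m
  have ev: "ev (mon (i, j, k)) = x l1 ^ i * x l2 ^ j * x l3 ^ k" for i j k
  proof -
    have "ev (mon (i, j, k)) = (\<Prod>l\<in>{l1, l2, l3}. x l ^ Poly_Mapping.lookup (mon (i, j, k)) l)"
      unfolding ev_def L(2) using mon_keys
      by (intro prod.mono_neutral_left) (auto simp: in_keys_iff)
    thus ?thesis using L(1) by (simp add: mon_lookup)
  qed
  have "eval_mpoly \<iota> x P = (\<Sum>m\<in>mon ` I. \<iota> (Poly_Mapping.lookup P m) * ev m)"
    unfolding eval_mpoly_def ev_def using P_keys I
    by (intro sum.mono_neutral_left) (auto simp: in_keys_iff emb_0)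
  also have "\<dots> = (\<Sum>t\<in>I. \<iota> (coef t) * ev (mon t))"
    by (subst sum.reindex[OF inj]) (simp add: P_lookup)
  also have "\<dots> = (\<Sum>(i, j, k)\<in>I. \<iota> (s i j k) * x l1 ^ i * x l2 ^ j * x l3 ^ k)"
    by (intro sum.cong) (auto simp: coef_def ev mult_ac)
  finally have "eval_mpoly \<iota> x P = 0" using sum by simp
  moreover have "\<forall>m\<in>Poly_Mapping.keys P. Poly_Mapping.keys m \<subseteq> {1..3}"
    using P_keys mon_keys by blast
  ultimately have "P = 0" using ind unfolding alg_independent_def by blast
  thus ?thesis using P_lookup[OF mem] by (simp add: coef_def)
qed

text \<open>Expanding coefficients repeatedly, first in \<open>x l2\<close>, then in
  \<open>x l3\<close>, ends in \<open>alg {}\<close>, the image of the base field. The relation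
  becomes a triple sum, and its vanishing coefficients propagate back outwards.\<close>

lemma alg_independent_transcendental:
  assumes ind: "alg_independent \<iota> {1..3} x" and L: "distinct [l1, l2, l3]" "{l1, l2, l3} = {1..3}"
  shows "transcendental_over (alg {x l2, x l3}) (x l1)"
  unfolding transcendental_over_def
proof safe
  fix p assume p: "p \<in> polys (alg {x l2, x l3})" and p0: "poly p (x l1) = 0"
  have "\<exists>q. q \<in> polys (alg {x l3}) \<and> coeff p i = poly q (x l2)" for i
    using alg_insert_poly[OF polysD[OF p, of i]] by metis
  then obtain q where q: "q i \<in> polys (alg {x l3})" "coeff p i = poly (q i) (x l2)" for i by metis
  have "\<exists>r. r \<in> polys (alg {}) \<and> coeff (q i) j = poly r (x l3)" for i j
    using alg_insert_poly[OF polysD[OF q(1), of i j]] by metis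
  then obtain r where r: "r i j \<in> polys (alg {})" "coeff (q i) j = poly (r i j) (x l3)" for i j
    by metis
  have "\<exists>c. coeff (r i j) k = \<iota> c" for i j k
    using polysD[OF r(1), of i j k] by (auto simp: alg_empty)
  then obtain s where s: "coeff (r i j) k = \<iota> (s i j k)" for i j k by metis
  define J where "J = (\<lambda>i. SIGMA j:{..degree (q i)}. {..degree (r i j)})"
  define I where "I = (SIGMA i:{..degree p}. J i)"
  have fin: "finite (J i)" "finite I" for i by (simp_all add: I_def J_def)
  have "poly p (x l1) = (\<Sum>i\<le>degree p. \<Sum>j\<le>degree (q i). \<Sum>k\<le>degree (r i j).
      \<iota> (s i j k) * x l1 ^ i * x l2 ^ j * x l3 ^ k)"
    by (simp add: poly_altdef[of p] poly_altdef[of "q _"] poly_altdef[of "r _ _"] q(2) r(2) s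
        sum_distrib_left sum_distrib_right mult_ac)
  also have "\<dots> = (\<Sum>(i, j, k)\<in>I. \<iota> (s i j k) * x l1 ^ i * x l2 ^ j * x l3 ^ k)"
    by (simp add: I_def J_def sum.Sigma fin)
  finally have 0: "(\<Sum>(i, j, k)\<in>I. \<iota> (s i j k) * x l1 ^ i * x l2 ^ j * x l3 ^ k) = 0"
    using p0 by simp
  have "coeff (r i j) k = 0" if "i \<le> degree p" "j \<le> degree (q i)" for i j k
  proof (cases "k \<le> degree (r i j)")
    case True
    hence "(i, j, k) \<in> I" using that by (simp add: I_def J_def)
    thus ?thesis
      using alg_independent_sum_eq_0[OF ind L fin(2) 0] by (simp add: s emb_0)
  qed (simp add: coeff_eq_0)
  hence "r i j = 0" if "i \<le> degree p" "j \<le> degree (q i)" for i j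
    using that by (auto simp: poly_eq_iff)
  hence "coeff (q i) j = 0" if "i \<le> degree p" for i j
    using that r(2)[of i j] by (cases "j \<le> degree (q i)") (auto simp: coeff_eq_0)
  hence "q i = 0" if "i \<le> degree p" for i using that by (auto simp: poly_eq_iff)
  hence "coeff p i = 0" for i using q(2)[of i] by (cases "i \<le> degree p") (auto simp: coeff_eq_0)
  thus "p = 0" by (auto simp: poly_eq_iff)
qed

text \<open>All three conditions are kept together so that the notion is symmetric in the variables
  and can be carried through mutations in one-variable terms.\<close>

definition independent :: "'f \<Rightarrow> 'f \<Rightarrow> 'f \<Rightarrow> bool" where
  "independent x y z \<longleftrightarrow> transcendental_over (alg {y, z}) x \<and>
     transcendental_over (alg {x, z}) y \<and> transcendental_over (alg {x, y}) z"

lemma independent_swap: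
  "independent x y z \<Longrightarrow> independent y x z" "independent x y z \<Longrightarrow> independent x z y"
  by (auto simp: independent_def insert_commute)

lemma alg_independent_imp_independent:
  assumes "alg_independent \<iota> {1..3} x"
  shows "independent (x 1) (x 2) (x 3)"
proof -
  have "{1..3} = {1, 2, 3::nat}" by auto
  thus ?thesis unfolding independent_def
    using alg_independent_transcendental[OF assms, of 1 2 3]
      alg_independent_transcendental[OF assms, of 2 1 3]
      alg_independent_transcendental[OF assms, of 3 1 2] by (simp add: insert_commute)
qed

lemma independent_nonzero:
  assumes "independent x y z"
  shows "x \<noteq> 0" "y \<noteq> 0" "z \<noteq> 0"
  using assms transcendental_nonzero[OF _ is_subalgebra_alg] unfolding independent_def by blast+

lemma independent_power_add_nonzero:
  assumes "independent x y z" "b > 0"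
  shows "x ^ b + y ^ c \<noteq> 0"
proof (rule transcendental_power_add_nonzero[OF _ is_subalgebra_alg])
  show "transcendental_over (alg {y, z}) x" using assms by (simp add: independent_def)
  show "y ^ c \<in> alg {y, z}" by (intro alg_closed(8) alg_incl) simp
qed (rule assms)

lemma independent_transcendental_laurent:
  assumes "independent x y z"
  shows "transcendental_over (alg {y, inverse y, z, inverse z}) x"
proof -
  have "transcendental_over (alg (insert (inverse y) (insert (inverse z) {y, z}))) x"
    using assms independent_nonzero[OF assms]
    by (intro transcendental_localise alg_incl) (auto simp: independent_def)
  thus ?thesis by (simp add: insert_commute)
qed

text \<open>Only \<open>c / x\<close> needs the mutation argument. For \<open>y\<close> and
  \<open>z\<close>, transcendence over one another survives adjoining \<open>c / x\<close> by
  \<open>transcendental_swap\<close>.\<close>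

lemma independent_mutate:
  assumes ind: "independent x y z" and c: "c \<in> alg {y, z}" "c \<noteq> 0"
  shows "independent (c / x) y z"
proof -
  have cx: "transcendental_over (alg {y, z}) (c / x)"
    using ind c by (intro transcendental_mutate) (auto simp: independent_def)
  have "transcendental_over (alg {z}) y" "transcendental_over (alg {y}) z"
    using ind alg_mono[of "{z}" "{x, z}"] alg_mono[of "{y}" "{x, y}"]
    by (auto simp: independent_def intro: transcendental_mono)
  hence "transcendental_over (alg (insert (c / x) {z})) y"
    "transcendental_over (alg (insert (c / x) {y})) z"
    using transcendental_swap[of "{z}" y "c / x"] transcendental_swap[of "{y}" z "c / x"] cx
    by (simp_all add: insert_commute)
  thus ?thesis using cx by (simp add: independent_def insert_commute)
qed

section \<open>Laurent rings, upper bounds and their behaviour under mutation\<close>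

definition laurent :: "'f \<Rightarrow> 'f \<Rightarrow> 'f \<Rightarrow> 'f set" where
  "laurent x y z = alg {x, inverse x, y, inverse y, z, inverse z}"

lemma laurent_swap: "laurent x y z = laurent y x z" "laurent x y z = laurent x z y"
  unfolding laurent_def by (rule arg_cong[of _ _ alg], blast)+

text \<open>
  Here \<open>a\<close>, \<open>b\<close>, \<open>c\<close> are the numbers of arrows between the two vertices other than that of
  \<open>x\<close>, \<open>y\<close>, \<open>z\<close> respectively, in a cyclic quiver of either orientation.
\<close>

definition upper_bound :: "'f \<Rightarrow> 'f \<Rightarrow> 'f \<Rightarrow> nat \<Rightarrow> nat \<Rightarrow> nat \<Rightarrow> 'f set" where
  "upper_bound x y z a b c = laurent x y z \<inter> laurent ((y ^ c + z ^ b) / x) y z \<inter>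
     laurent x ((x ^ c + z ^ a) / y) z \<inter> laurent x y ((x ^ b + y ^ a) / z)"

lemma upper_bound_swap:
  "upper_bound x y z a b c = upper_bound y x z b a c"
  "upper_bound x y z a b c = upper_bound x z y a c b"
proof -
  show "upper_bound x y z a b c = upper_bound y x z b a c"
  proof -
    have eqs: "laurent x y z = laurent y x z"
      "laurent ((y ^ c + z ^ b) / x) y z = laurent y ((y ^ c + z ^ b) / x) z"
      "laurent x ((x ^ c + z ^ a) / y) z = laurent ((x ^ c + z ^ a) / y) x z"
      "laurent x y ((x ^ b + y ^ a) / z) = laurent y x ((y ^ a + x ^ b) / z)"
      by (rule laurent_swap(1), rule laurent_swap(1), rule laurent_swap(1),
          subst add.commute, rule laurent_swap(1))
    show ?thesis unfolding upper_bound_def eqs by blast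
  qed
  show "upper_bound x y z a b c = upper_bound x z y a c b"
  proof -
    have eqs: "laurent x y z = laurent x z y"
      "laurent ((y ^ c + z ^ b) / x) y z = laurent ((z ^ b + y ^ c) / x) z y"
      "laurent x ((x ^ c + z ^ a) / y) z = laurent x z ((x ^ c + z ^ a) / y)"
      "laurent x y ((x ^ b + y ^ a) / z) = laurent x ((x ^ b + y ^ a) / z) y"
      by (rule laurent_swap(2), subst add.commute, rule laurent_swap(2), rule laurent_swap(2),
          rule laurent_swap(2))
    show ?thesis unfolding upper_bound_def eqs by blast
  qed
qed

lemma is_subalgebra_upper_bound: "is_subalgebra \<iota> (upper_bound x y z a b c)"
  using is_subalgebra_alg unfolding upper_bound_def laurent_def is_subalgebra_def by blast

text \<open>This is the rank two result for the vertices of \<open>x\<close> and \<open>y\<close>,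
  with \<open>u = z ^ b\<close> and \<open>v = z ^ a\<close>, which are units because
  \<open>z\<close> is inverted.\<close>

lemma laurent_exchange:
  assumes ind: "independent x y z" and c: "c > 0"
    and f: "f \<in> laurent x y z" "f \<in> laurent ((y ^ c + z ^ b) / x) y z"
      "f \<in> laurent x ((x ^ c + z ^ a) / y) z"
  shows "f \<in> alg {x, (y ^ c + z ^ b) / x, y, (x ^ c + z ^ a) / y, z, inverse z}"
proof -
  let ?x' = "(y ^ c + z ^ b) / x" and ?y' = "(x ^ c + z ^ a) / y"
  have nz: "x \<noteq> 0" "y \<noteq> 0" "z \<noteq> 0" using independent_nonzero[OF ind] by auto
  have "f \<in> alg ({x, ?x', y, ?y'} \<union> {z, inverse z})"
  proof (rule rank2_upper_bound[where u = "z ^ b" and v = "z ^ a" and b = c])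
    show "transcendental_over (alg (insert (inverse y) (insert y {z, inverse z}))) x"
      using independent_transcendental_laurent[OF ind] by (simp add: insert_commute)
    show "transcendental_over (alg (insert (inverse x) (insert x {z, inverse z}))) y"
      using independent_transcendental_laurent[OF independent_swap(1)[OF ind]]
      by (simp add: insert_commute)
    show "inverse (z ^ b) \<in> alg {z, inverse z}"
      unfolding power_inverse[symmetric] by (intro alg_closed(8) alg_incl) simp
    show "z ^ b \<in> alg {z, inverse z}" "z ^ a \<in> alg {z, inverse z}"
      by (intro alg_closed(8) alg_incl; simp)+
    show "f \<in> alg ({x, inverse x, y, inverse y} \<union> {z, inverse z})"
      "f \<in> alg ({?x', inverse ?x', y, inverse y} \<union> {z, inverse z})"
      "f \<in> alg ({x, inverse x, ?y', inverse ?y'} \<union> {z, inverse z})"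
      using f by (simp_all only: laurent_def Un_insert_left Un_empty_left)
  qed (use nz c in auto)
  thus ?thesis by (simp only: Un_insert_left Un_empty_left)
qed

text \<open>By \<open>laurent_exchange\<close>, \<open>f\<close> lies in the algebra generated by
  both exchange pairs; by \<open>rank2_mutation\<close> this algebra is contained in the Laurent
  ring of the neighbour at \<open>y\<close> of the seed mutated at \<open>x\<close>.\<close>

lemma laurent_mutate:
  assumes ind: "independent x y z" and pos: "c > 0" and a': "a + a' = b * c"
    and x': "x' = (y ^ c + z ^ b) / x"
    and f: "f \<in> laurent x y z" "f \<in> laurent x' y z" "f \<in> laurent x ((x ^ c + z ^ a) / y) z"
  shows "f \<in> laurent x' ((x' ^ c + z ^ a') / y) z"
proof -
  let ?y' = "(x ^ c + z ^ a) / y" and ?y'' = "(x' ^ c + z ^ a') / y"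
  have nz: "x \<noteq> 0" "y \<noteq> 0" "z \<noteq> 0" using independent_nonzero[OF ind] by auto
  have "y ^ c + z ^ b \<noteq> 0"
    using independent_power_add_nonzero[OF independent_swap(2)[OF independent_swap(1)[OF ind]] pos] .
  hence x'0: "x' \<noteq> 0" using nz x' by simp
  have "independent x' y z"
    unfolding x' using \<open>y ^ c + z ^ b \<noteq> 0\<close> ind
    by (intro independent_mutate alg_closed(4,8) alg_incl) auto
  hence y''0: "?y'' \<noteq> 0"
    using independent_power_add_nonzero[OF independent_swap(2) pos] nz by simp
  \<comment> \<open>The coefficient \<open>u ^ c / v\<close> of the second exchange is
    \<open>z ^ a'\<close>, since \<open>a'\<close> is the arrow number after mutation.\<close>
  have "z ^ a * z ^ a' = (z ^ b) ^ c" by (simp add: a' flip: power_add power_mult)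
  hence "(z ^ b) ^ c / z ^ a = z ^ a'" using nz by (simp add: field_simps)
  moreover have "z ^ n \<in> alg {z, inverse z}" "inverse (z ^ n) \<in> alg {z, inverse z}" for n
    unfolding power_inverse[symmetric] by (intro alg_closed(8) alg_incl; simp)+
  ultimately have "alg ({x, x', y, ?y'} \<union> {z, inverse z}) \<subseteq>
      alg ({x', inverse x', ?y'', inverse ?y''} \<union> {z, inverse z})"
    using nz x'0 y''0 pos x'
    by (intro rank2_mutation[where u = "z ^ b" and v = "z ^ a" and b = c]) auto
  moreover have "f \<in> alg ({x, x', y, ?y'} \<union> {z, inverse z})"
    using laurent_exchange[OF ind pos f(1) _ f(3)] f(2)
    unfolding x' by (simp only: Un_insert_left Un_empty_left)
  ultimately show ?thesis
    unfolding laurent_def by (auto simp only: Un_insert_left Un_empty_left)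
qed

text \<open>The Laurent rings at \<open>x\<close> and \<open>x'\<close> only trade places. For the
  neighbours at \<open>y\<close> and \<open>z\<close>, mutation at \<open>x\<close> is an
  involution, so \<open>laurent_mutate\<close> is applied from the seed at \<open>x'\<close> back to
  the one at \<open>x\<close>. This direction of the inclusion keeps all upper bounds inside the
  initial one along a sequence of mutations.\<close>

lemma upper_bound_mutate:
  assumes ind: "independent x y z" and pos: "b > 0" "c > 0" and a': "a + a' = b * c"
    and x': "x' = (y ^ c + z ^ b) / x"
  shows "upper_bound x' y z a' b c \<subseteq> upper_bound x y z a b c"
proof
  fix f assume f: "f \<in> upper_bound x' y z a' b c"
  have nz: "x \<noteq> 0" "y \<noteq> 0" "z \<noteq> 0" using independent_nonzero[OF ind] by auto
  have c0: "y ^ c + z ^ b \<noteq> 0"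
    using independent_power_add_nonzero[OF independent_swap(2)[OF independent_swap(1)[OF ind]] pos(2)] .
  have ind': "independent x' y z"
    unfolding x' using c0 ind by (intro independent_mutate alg_closed(4,8) alg_incl) auto
  have x: "x = (y ^ c + z ^ b) / x'" unfolding x' using c0 nz by simp
  have f1: "f \<in> laurent x' y z" "f \<in> laurent x y z"
    "f \<in> laurent x' ((x' ^ c + z ^ a') / y) z" "f \<in> laurent x' y ((x' ^ b + y ^ a') / z)"
    using f x unfolding upper_bound_def by auto
  have "f \<in> laurent x ((x ^ c + z ^ a) / y) z"
    using a' by (intro laurent_mutate[OF ind' pos(2) _ x f1(1,2,3)]) simp
  moreover have "f \<in> laurent x ((x ^ b + y ^ a) / z) y"
    using a' x f1
    by (intro laurent_mutate[OF independent_swap(2)[OF ind'] pos(1), of a' a c])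
       (auto simp: laurent_swap(2)[of _ _ y] add.commute mult.commute)
  ultimately show "f \<in> upper_bound x y z a b c"
    using f1 laurent_swap(2)[of x _ y] x' unfolding upper_bound_def by auto
qed

text \<open>Only the Laurent ring with \<open>x\<close> replaced lacks \<open>x\<close> as a
  generator; there \<open>x\<close> is the exchange numerator times the inverse of the new
  variable.\<close>

lemma cluster_var_in_upper_bound:
  assumes ind: "independent x y z" and pos: "b > 0" "c > 0"
  shows "x \<in> upper_bound x y z a b c"
proof -
  let ?x' = "(y ^ c + z ^ b) / x"
  have nz: "x \<noteq> 0" using independent_nonzero[OF ind] by auto
  have c0: "y ^ c + z ^ b \<noteq> 0"
    using independent_power_add_nonzero[OF independent_swap(2)[OF independent_swap(1)[OF ind]] pos(2)] .
  have "x = (y ^ c + z ^ b) * inverse ?x'" using c0 nz by (simp add: field_simps)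
  also have "\<dots> \<in> laurent ?x' y z"
    unfolding laurent_def by (intro alg_closed(4,5,8) alg_incl) auto
  finally have "x \<in> laurent ?x' y z" .
  thus ?thesis unfolding upper_bound_def by (auto simp: laurent_def intro: alg_incl)
qed

end

section \<open>Mutation of cyclic quivers on three vertices\<close>

lemma prod_three_vertices: "prod h {1..3::nat} = h 1 * h 2 * (h 3 :: 'a::comm_monoid_mult)"
proof -
  have "{1..3} = {1, 2, 3::nat}" by auto
  thus ?thesis by (simp add: mult_ac)
qed

text \<open>Each arrow number is indexed by the opposite vertex, as in
  \<open>upper_bound\<close>.\<close>

definition cyclic_arrows :: "nat \<Rightarrow> nat \<Rightarrow> nat \<Rightarrow> nat \<Rightarrow> nat \<Rightarrow> nat" where
  "cyclic_arrows a b c i j =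
     (if (i, j) = (1, 2) then c else if (i, j) = (2, 3) then a else if (i, j) = (3, 1) then b else 0)"

lemma vertex_cases:
  fixes i :: nat
  obtains "i = 1" | "i = 2" | "i = 3" | "i \<noteq> 1" "i \<noteq> 2" "i \<noteq> 3"
  by blast

text \<open>Paths through vertex 1 create \<open>b * c\<close> arrows against the \<open>a\<close>
  existing ones, so \<open>a'\<close> remain after cancellation. The result is again cyclic, with
  the orientation reversed.\<close>

lemma mutate_quiver_cyclic_arrows:
  "a + a' = b * c \<Longrightarrow> mutate_quiver 1 (cyclic_arrows a b c) = (\<lambda>i j. cyclic_arrows a' b c j i)"
  "b + b' = a * c \<Longrightarrow> mutate_quiver 2 (cyclic_arrows a b c) = (\<lambda>i j. cyclic_arrows a b' c j i)"
  "c + c' = a * b \<Longrightarrow> mutate_quiver 3 (cyclic_arrows a b c) = (\<lambda>i j. cyclic_arrows a b c' j i)"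
proof (goal_cases)
  case 1
  show ?case
  proof (intro ext)
    show "mutate_quiver 1 (cyclic_arrows a b c) i j = cyclic_arrows a' b c j i" for i j
      using 1 by (cases i rule: vertex_cases; cases j rule: vertex_cases)
        (simp_all add: mutate_quiver_def cyclic_arrows_def mult.commute)
  qed
next
  case 2
  show ?case
  proof (intro ext)
    show "mutate_quiver 2 (cyclic_arrows a b c) i j = cyclic_arrows a b' c j i" for i j
      using 2 by (cases i rule: vertex_cases; cases j rule: vertex_cases)
        (simp_all add: mutate_quiver_def cyclic_arrows_def mult.commute)
  qed
next
  case 3
  show ?case
  proof (intro ext)
    show "mutate_quiver 3 (cyclic_arrows a b c) i j = cyclic_arrows a b c' j i" for i j
      using 3 by (cases i rule: vertex_cases; cases j rule: vertex_cases)
        (simp_all add: mutate_quiver_def cyclic_arrows_def mult.commute)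
  qed
qed

lemma mutate_quiver_reverse:
  "mutate_quiver l (\<lambda>i j. q j i) = (\<lambda>i j. mutate_quiver l q j i)"
  by (intro ext) (simp add: mutate_quiver_def mult.commute)

lemma mutate_quiver_cyclic_arrows_reverse:
  "a + a' = b * c \<Longrightarrow> mutate_quiver 1 (\<lambda>i j. cyclic_arrows a b c j i) = cyclic_arrows a' b c"
  "b + b' = a * c \<Longrightarrow> mutate_quiver 2 (\<lambda>i j. cyclic_arrows a b c j i) = cyclic_arrows a b' c"
  "c + c' = a * b \<Longrightarrow> mutate_quiver 3 (\<lambda>i j. cyclic_arrows a b c j i) = cyclic_arrows a b c'"
  by (simp_all only: mutate_quiver_reverse[of _ "cyclic_arrows a b c"] mutate_quiver_cyclic_arrows)

text \<open>Vieta jumping: with \<open>b * c = a + a'\<close> the inequality reads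
  \<open>b * b + c * c \<le> a * a'\<close>, which is symmetric in \<open>a\<close> and
  \<open>a'\<close>. Since \<open>b > 0\<close>, it also forces \<open>a < b * c\<close>, hence
  \<open>a' > 0\<close>.\<close>

lemma cyclic_arrows_mutation_step:
  fixes a b c :: nat
  assumes "a > 0" "b > 0" "a * a + b * b + c * c \<le> a * b * c"
  obtains a' where "a' > 0" "a + a' = b * c" "a' * a' + b * b + c * c \<le> a' * b * c"
proof -
  have "a * a < a * a + b * b" using assms by simp
  also have "\<dots> \<le> a * (b * c)" using assms(3) by (simp add: mult.assoc)
  finally have "a < b * c" by simp
  then obtain d where d: "b * c = a + d" "d > 0" using less_imp_add_positive by metis
  have "a * a + b * b + c * c \<le> a * (a + d)"
    using assms(3) unfolding mult.assoc d .
  hence "d * d + b * b + c * c \<le> d * (a + d)" by (simp add: algebra_simps)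
  hence "d * d + b * b + c * c \<le> d * b * c" unfolding mult.assoc d .
  thus ?thesis using that d by simp
qed

context field_extension
begin

section \<open>The cluster algebra inside the upper bound of the initial seed\<close>

definition seed_in :: "'f set \<Rightarrow> 'f seed \<Rightarrow> bool" where
  "seed_in U T \<longleftrightarrow> rank T = 3 \<and> frozen T = {} \<and>
     independent (cluster_var T 1) (cluster_var T 2) (cluster_var T 3) \<and>
     (\<exists>a b c. a > 0 \<and> b > 0 \<and> c > 0 \<and> a * a + b * b + c * c \<le> a * b * c \<and>
        (arrows T = cyclic_arrows a b c \<or> arrows T = (\<lambda>i j. cyclic_arrows a b c j i)) \<and>
        upper_bound (cluster_var T 1) (cluster_var T 2) (cluster_var T 3) a b c \<subseteq> U)"

lemma independent_exchange:
  assumes "independent x y z" "c > 0"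
  shows "independent ((y ^ c + z ^ b) / x) y z"
proof -
  have "y ^ c + z ^ b \<noteq> 0"
    using independent_power_add_nonzero[OF independent_swap(2)[OF independent_swap(1)[OF assms(1)]] assms(2)] .
  thus ?thesis using assms(1) by (intro independent_mutate alg_closed(4,8) alg_incl) auto
qed

lemma seed_in_mutate:
  assumes T: "seed_in U T" and l: "l \<in> mutable T"
  shows "seed_in U (mutate l T)"
proof -
  define x y z where "x = cluster_var T 1" and "y = cluster_var T 2" and "z = cluster_var T 3"
  obtain a b c where abc: "a > 0" "b > 0" "c > 0" "a * a + b * b + c * c \<le> a * b * c"
    and q: "arrows T = cyclic_arrows a b c \<or> arrows T = (\<lambda>i j. cyclic_arrows a b c j i)"
    and U: "upper_bound x y z a b c \<subseteq> U"
    using T unfolding seed_in_def x_def y_def z_def by blast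
  have ind: "independent x y z" and T3: "rank T = 3" "frozen T = {}"
    using T unfolding seed_in_def x_def y_def z_def by blast+
  have mut: "cluster_var (mutate l T) = (cluster_var T)(l :=
      (x ^ arrows T 1 l * y ^ arrows T 2 l * z ^ arrows T 3 l +
       x ^ arrows T l 1 * y ^ arrows T l 2 * z ^ arrows T l 3) / cluster_var T l)" for l
    unfolding x_def y_def z_def by (simp only: mutate_def T3 prod_three_vertices divide_inverse) simp
  have arr: "arrows (mutate l T) = mutate_quiver l (arrows T)" for l by (simp add: mutate_def)
  have "l = 1 \<or> l = 2 \<or> l = 3" using l T3 by (auto simp: mutable_def)
  thus ?thesis
  proof (elim disjE)
    assume l: "l = 1"
    obtain a' where a': "a' > 0" "a + a' = b * c" "a' * a' + b * b + c * c \<le> a' * b * c"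
      using cyclic_arrows_mutation_step[OF abc(1,2,4)] .
    let ?x' = "(y ^ c + z ^ b) / x"
    have "upper_bound ?x' y z a' b c \<subseteq> U"
      using upper_bound_mutate[OF ind abc(2,3) a'(2) HOL.refl] U by blast
    moreover have "cluster_var (mutate l T) 1 = ?x'" "cluster_var (mutate l T) 2 = y"
      "cluster_var (mutate l T) 3 = z"
      using q unfolding l mut
      by (auto simp: cyclic_arrows_def x_def y_def z_def add.commute simp del: One_nat_def)
    moreover have "arrows (mutate l T) = cyclic_arrows a' b c \<or>
        arrows (mutate l T) = (\<lambda>i j. cyclic_arrows a' b c j i)"
      using q mutate_quiver_cyclic_arrows(1)[OF a'(2)]
        mutate_quiver_cyclic_arrows_reverse(1)[OF a'(2)]
      unfolding arr l by (elim disjE) (simp_all only: simp_thms)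
    ultimately show ?thesis
      using T3 a' abc independent_exchange[OF ind abc(3), of b] unfolding seed_in_def
      by (intro conjI exI[of _ a'] exI[of _ b] exI[of _ c]) (simp_all add: mutate_def)
  next
    \<comment> \<open>Mutation at vertices 2 and 3 reduces to the statement for the first variable
      by permuting the variables together with the arrow numbers.\<close>
    assume l: "l = 2"
    have "b * b + a * a + c * c \<le> b * a * c" using abc(4) by (simp add: mult.commute add.commute)
    then obtain b' where b': "b' > 0" "b + b' = a * c" "b' * b' + a * a + c * c \<le> b' * a * c"
      using cyclic_arrows_mutation_step[OF abc(2,1)] by blast
    let ?y' = "(x ^ c + z ^ a) / y"
    have "upper_bound ?y' x z b' a c \<subseteq> U"
      using upper_bound_mutate[OF independent_swap(1)[OF ind] abc(1,3) b'(2) HOL.refl] U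
        upper_bound_swap(1)[of x y] by blast
    hence "upper_bound x ?y' z a b' c \<subseteq> U" using upper_bound_swap(1) by blast
    moreover have "cluster_var (mutate l T) 1 = x" "cluster_var (mutate l T) 2 = ?y'"
      "cluster_var (mutate l T) 3 = z"
      using q unfolding l mut
      by (auto simp: cyclic_arrows_def x_def y_def z_def add.commute simp del: One_nat_def)
    moreover have "arrows (mutate l T) = cyclic_arrows a b' c \<or>
        arrows (mutate l T) = (\<lambda>i j. cyclic_arrows a b' c j i)"
      using q mutate_quiver_cyclic_arrows(2)[OF b'(2)]
        mutate_quiver_cyclic_arrows_reverse(2)[OF b'(2)]
      unfolding arr l by (elim disjE) (simp_all only: simp_thms)
    moreover have "a * a + b' * b' + c * c \<le> a * b' * c"
      using b'(3) by (simp add: mult.commute add.commute)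
    moreover have "independent x ?y' z"
      using independent_swap(1)[OF independent_exchange[OF independent_swap(1)[OF ind] abc(3)]] .
    ultimately show ?thesis
      using T3 b' abc unfolding seed_in_def
      by (intro conjI exI[of _ a] exI[of _ b'] exI[of _ c]) (simp_all add: mutate_def)
  next
    assume l: "l = 3"
    have "c * c + a * a + b * b \<le> c * a * b" using abc(4) by (simp add: mult_ac add_ac)
    then obtain c' where c': "c' > 0" "c + c' = a * b" "c' * c' + a * a + b * b \<le> c' * a * b"
      using cyclic_arrows_mutation_step[OF abc(3,1)] by blast
    let ?z' = "(x ^ b + y ^ a) / z"
    have ind': "independent z x y"
      using independent_swap(1)[OF independent_swap(2)[OF ind]] .
    have "upper_bound ?z' x y c' a b \<subseteq> U"
      using upper_bound_mutate[OF ind' abc(1,2) c'(2) HOL.refl] U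
        upper_bound_swap(1)[of x z y] upper_bound_swap(2)[of x y z] by blast
    hence "upper_bound x y ?z' a b c' \<subseteq> U"
      using upper_bound_swap(1)[of x ?z' y] upper_bound_swap(2)[of x y ?z'] by blast
    moreover have "cluster_var (mutate l T) 1 = x" "cluster_var (mutate l T) 2 = y"
      "cluster_var (mutate l T) 3 = ?z'"
      using q unfolding l mut
      by (auto simp: cyclic_arrows_def x_def y_def z_def add.commute simp del: One_nat_def)
    moreover have "arrows (mutate l T) = cyclic_arrows a b c' \<or>
        arrows (mutate l T) = (\<lambda>i j. cyclic_arrows a b c' j i)"
      using q mutate_quiver_cyclic_arrows(3)[OF c'(2)]
        mutate_quiver_cyclic_arrows_reverse(3)[OF c'(2)]
      unfolding arr l by (elim disjE) (simp_all only: simp_thms)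
    moreover have "a * a + b * b + c' * c' \<le> a * b * c'"
      using c'(3) by (simp add: mult_ac add_ac)
    moreover have "independent x y ?z'"
      using independent_swap(2)[OF independent_swap(1)[OF independent_exchange[OF ind' abc(2)]]] .
    ultimately show ?thesis
      using T3 c' abc unfolding seed_in_def
      by (intro conjI exI[of _ a] exI[of _ b] exI[of _ c']) (simp_all add: mutate_def)
  qed
qed

lemma seed_in_cluster_var:
  assumes T: "seed_in U T" and "i \<in> {1..rank T}"
  shows "cluster_var T i \<in> U"
proof -
  define x y z where "x = cluster_var T 1" and "y = cluster_var T 2" and "z = cluster_var T 3"
  obtain a b c where abc: "a > 0" "b > 0" "c > 0" and U: "upper_bound x y z a b c \<subseteq> U"
    using T unfolding seed_in_def x_def y_def z_def by blast
  have ind: "independent x y z" using T unfolding seed_in_def x_def y_def z_def by blast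
  have "x \<in> upper_bound x y z a b c" by (rule cluster_var_in_upper_bound[OF ind abc(2,3)])
  moreover have "y \<in> upper_bound x y z a b c"
    using cluster_var_in_upper_bound[OF independent_swap(1)[OF ind] abc(1,3)] upper_bound_swap(1)
    by blast
  moreover have "z \<in> upper_bound x y z a b c"
    using cluster_var_in_upper_bound[OF independent_swap(1)[OF independent_swap(2)[OF ind]] abc(1,2)]
      upper_bound_swap(1)[of x z y] upper_bound_swap(2)[of x y z] by blast
  moreover have "i = 1 \<or> i = 2 \<or> i = 3" using assms unfolding seed_in_def by auto
  ultimately show ?thesis using U unfolding x_def y_def z_def by blast
qed

lemma cluster_algebra_subset_upper_bound:
  assumes x: "alg_independent \<iota> {1..3} x" and a: "a \<ge> 3"
  shows "cluster_algebra \<iota> (cyclic_seed a x) \<subseteq> upper_bound (x 1) (x 2) (x 3) a a a" (is "_ \<subseteq> ?U")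
proof -
  let ?S = "cyclic_seed a x"
  \<comment> \<open>For three equal arrow numbers the invariant inequality says
    \<open>3 * a ^ 2 \<le> a ^ 3\<close>, which is where \<open>a \<ge> 3\<close> enters.\<close>
  have "a * a + a * a + a * a = 3 * (a * a)" by simp
  also have "\<dots> \<le> a * (a * a)" using a by (rule mult_right_mono) simp
  finally have "a * a + a * a + a * a \<le> a * a * a" by (simp only: mult.assoc)
  moreover have "cyclic_quiver a = cyclic_arrows a a a"
    by (intro ext) (simp add: cyclic_quiver_def cyclic_arrows_def)
  ultimately have S: "seed_in ?U ?S"
    using a alg_independent_imp_independent[OF x] unfolding seed_in_def
    by (intro conjI exI[of _ a]) (simp_all add: cyclic_seed_def)
  have seeds: "seed_in ?U T" if "mutation_equivalent ?S T" for T
    using that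
  proof induction
    case refl
    show ?case by (rule S)
  next
    case (step T l)
    show ?case by (rule seed_in_mutate[OF step.IH step.hyps(2)])
  qed
  have "frozen ?S = {}" by (simp add: cyclic_seed_def)
  hence "(\<Union>T\<in>{T. mutation_equivalent ?S T}. cluster_var T ` {1..rank T}) \<union>
      (\<lambda>i. inverse (cluster_var ?S i)) ` frozen ?S \<subseteq> ?U"
    using seed_in_cluster_var[OF seeds] by blast
  thus ?thesis
    unfolding cluster_algebra_def by (intro hull_minimal is_subalgebra_upper_bound)
qed

section \<open>Tight closure\<close>

text \<open>The multiplier \<open>z ^ a\<close> does not depend on \<open>q\<close>: as
  \<open>q\<close> runs through the powers of the characteristic, this puts
  \<open>z ^ (a - 1)\<close> in the tight closure of the ideal generated by \<open>x\<close> and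
  \<open>y\<close>.\<close>

lemma tight_closure_certificate:
  assumes a: "a \<ge> 3" and rel: "x * y * z * M = x ^ a + y ^ a + z ^ a" and q: "q > 0"
  obtains g h where "g \<in> alg {x, y, z, M}" "h \<in> alg {x, y, z, M}"
    "z ^ a * (z ^ (a - 1)) ^ q = g * x ^ q + h * y ^ q"
proof -
  define B where "B = alg {x, y, z, M}"
  have B: "is_subalgebra \<iota> B" unfolding B_def by (rule is_subalgebra_alg)
  note Bc = subalgebra_closed[OF B]
  have in_B: "x \<in> B" "y \<in> B" "z \<in> B" "M \<in> B" unfolding B_def by (auto intro: alg_incl)
  define J where "J = {g * x ^ q + h * y ^ q |g h. g \<in> B \<and> h \<in> B}"
  have J_diff: "f - f' \<in> J" if ff': "f \<in> J" "f' \<in> J" for f f'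
  proof -
    obtain g h g' h' where *: "g \<in> B" "h \<in> B" "f = g * x ^ q + h * y ^ q"
      "g' \<in> B" "h' \<in> B" "f' = g' * x ^ q + h' * y ^ q" using ff' unfolding J_def by blast
    have "f - f' = (g - g') * x ^ q + (h - h') * y ^ q" by (simp add: * algebra_simps)
    moreover have "g - g' \<in> B" "h - h' \<in> B" by (rule Bc(7)[OF *(1,4)] Bc(7)[OF *(2,5)])+
    ultimately show ?thesis unfolding J_def by blast
  qed
  have J_mult: "r * f \<in> J" if r: "r \<in> B" and f: "f \<in> J" for r f
  proof -
    obtain g h where *: "g \<in> B" "h \<in> B" "f = g * x ^ q + h * y ^ q" using f unfolding J_def by blast
    have "r * f = (r * g) * x ^ q + (r * h) * y ^ q" by (simp add: * algebra_simps)
    moreover have "r * g \<in> B" "r * h \<in> B" by (rule Bc(5)[OF r *(1)] Bc(5)[OF r *(2)])+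
    ultimately show ?thesis unfolding J_def by blast
  qed
  have J_x: "g * x ^ q \<in> J" and J_y: "g * y ^ q \<in> J" if g: "g \<in> B" for g
  proof -
    have "g * x ^ q = g * x ^ q + 0 * y ^ q" "g * y ^ q = 0 * x ^ q + g * y ^ q" by simp_all
    thus "g * x ^ q \<in> J" "g * y ^ q \<in> J" unfolding J_def using g Bc(2) by blast+
  qed
  have J_mon: "x ^ i * y ^ j * z ^ n \<in> J" if ij: "i \<ge> q \<or> j \<ge> q" for i j n
    using ij
  proof
    assume "i \<ge> q"
    hence "x ^ i = x ^ (i - q) * x ^ q" by (simp flip: power_add)
    hence "x ^ i * y ^ j * z ^ n = (x ^ (i - q) * y ^ j * z ^ n) * x ^ q" by (simp add: mult_ac)
    also have "\<dots> \<in> J" using in_B by (intro J_x Bc(5,8))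
    finally show ?thesis .
  next
    assume "j \<ge> q"
    hence "y ^ j = y ^ (j - q) * y ^ q" by (simp flip: power_add)
    hence "x ^ i * y ^ j * z ^ n = (x ^ i * y ^ (j - q) * z ^ n) * y ^ q" by (simp add: mult_ac)
    also have "\<dots> \<in> J" using in_B by (intro J_y Bc(5,8))
    finally show ?thesis .
  qed
  text \<open>
    Rewriting \<open>z^a = x y z M - x^a - y^a\<close> lowers the exponent of \<open>z\<close> by \<open>a\<close> or \<open>a - 1\<close>; the
    bound \<open>cost i j\<close> on the exponent needed to reach \<open>(x^q, y^q)\<close> drops at least as much.
  \<close>
  define cost where "cost i j = (q - 1 - i) + (q - 1 - j) + (a - 3) * min (q - 1 - i) (q - 1 - j)"
    for i j
  have cost_mono: "cost i' j + (i' - i) \<le> cost i j" if "i \<le> i'" "i' < q" for i i' j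
  proof -
    have "min (q - 1 - i') (q - 1 - j) \<le> min (q - 1 - i) (q - 1 - j)" using that by auto
    hence "(a - 3) * min (q - 1 - i') (q - 1 - j) \<le> (a - 3) * min (q - 1 - i) (q - 1 - j)"
      by (rule mult_le_mono2)
    moreover have "q - 1 - i' + (i' - i) = q - 1 - i" using that by simp
    ultimately show ?thesis unfolding cost_def by linarith
  qed
  have cost_sym: "cost i j = cost j i" for i j by (simp add: cost_def min.commute)
  \<comment> \<open>Raising both exponents by one lowers the two linear terms by 2 and the
    \<open>min\<close> term by \<open>a - 3\<close>, which matches the loss of \<open>a - 1\<close>
    in the exponent of \<open>z\<close>.\<close>
  have cost_diag: "cost (i + 1) (j + 1) + (a - 1) = cost i j" if "i + 1 < q" "j + 1 < q" for i j
  proof -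
    define u v where "u = q - 1 - (i + 1)" and "v = q - 1 - (j + 1)"
    have "q - 1 - i = Suc u" "q - 1 - j = Suc v" using that by (auto simp: u_def v_def)
    moreover obtain k where "a = k + 3" using a by (metis add.commute le_Suc_ex)
    ultimately show ?thesis unfolding cost_def u_def[symmetric] v_def[symmetric] by simp
  qed
  have key: "x ^ i * y ^ j * z ^ n \<in> J" if n: "i < q \<Longrightarrow> j < q \<Longrightarrow> n \<ge> a + cost i j" for i j n
    using n
  proof (induction n arbitrary: i j rule: less_induct)
    case (less n)
    show ?case
    proof (cases "i < q \<and> j < q")
      case False
      thus ?thesis using J_mon by auto
    next
      case True
      hence n: "n \<ge> a + cost i j" using less.prems by blast
      have "z ^ a = x * y * z * M - x ^ a - y ^ a" using rel by simp
      moreover have "z ^ n = z ^ (n - a) * z ^ a" using n by (simp flip: power_add)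
      ultimately have "x ^ i * y ^ j * z ^ n =
          x ^ i * y ^ j * (z ^ (n - a) * (x * y * z * M - x ^ a - y ^ a))" by (simp only:)
      also have "\<dots> =
          M * (x ^ (i + 1) * y ^ (j + 1) * z ^ (n - a + 1)) - x ^ (i + a) * y ^ j * z ^ (n - a)
          - x ^ i * y ^ (j + a) * z ^ (n - a)"
        by (simp add: algebra_simps power_add)
      also have "\<dots> \<in> J"
      proof (rule J_diff[OF J_diff[OF J_mult[OF in_B(4)]]])
        show "x ^ (i + 1) * y ^ (j + 1) * z ^ (n - a + 1) \<in> J"
          using n a cost_diag[of i j] by (intro less.IH) auto
        show "x ^ (i + a) * y ^ j * z ^ (n - a) \<in> J"
          using n a cost_mono[of i "i + a" j] by (intro less.IH) auto
        show "x ^ i * y ^ (j + a) * z ^ (n - a) \<in> J"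
          using n a cost_mono[of j "j + a" i] cost_sym by (intro less.IH) auto
      qed
      finally show ?thesis .
    qed
  qed
  \<comment> \<open>At the start the two linear terms and the \<open>min\<close> term add up to
    \<open>(2 + (a - 3)) * (q - 1)\<close>, so exponent \<open>a + (a - 1) * q\<close>
    suffices.\<close>
  have "cost 0 0 = (a - 1) * (q - 1)"
  proof -
    obtain k where "a = k + 3" using a by (metis add.commute le_Suc_ex)
    moreover obtain r where "q = Suc r" using q gr0_implies_Suc by blast
    ultimately show ?thesis by (simp add: cost_def)
  qed
  also have "\<dots> \<le> (a - 1) * q" by simp
  finally have "x ^ 0 * y ^ 0 * z ^ (a + (a - 1) * q) \<in> J" by (intro key) simp
  hence "z ^ a * (z ^ (a - 1)) ^ q \<in> J" by (simp add: power_add power_mult)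
  thus ?thesis using that unfolding J_def B_def by blast
qed

end

section \<open>Frobenius roots and the consequence of strong F-regularity\<close>

lemma frobenius_power_inject:
  fixes u v :: "'a::field"
  assumes "prime CHAR('a)" "u ^ CHAR('a) ^ e = v ^ CHAR('a) ^ e"
  shows "u = v"
proof -
  have "u ^ CHAR('a) ^ e = ((u - v) + v) ^ CHAR('a) ^ e" by simp
  also have "\<dots> = (u - v) ^ CHAR('a) ^ e + v ^ CHAR('a) ^ e"
    by (rule freshmans_dream'[OF assms(1) HOL.refl])
  finally show ?thesis using assms(2) by simp
qed

context field_extension
begin

text \<open>
  A map \<open>\<psi>\<close> with \<open>\<psi> (c^(1/q)) = 1\<close> sends the \<open>q\<close>-th root of the given relation to the
  claimed one; the denominators are cleared by \<open>\<psi>\<close> being linear over \<open>A\<close>.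
\<close>

lemma strongly_F_regular_tight_closure:
  assumes A: "is_subalgebra \<iota> A" and reg: "strongly_F_regular A" and p: "prime CHAR('f)"
    and mem: "x \<in> A" "y \<in> A" "c \<in> A" "c \<noteq> 0" "f \<in> A"
    and S: "S \<noteq> {}" "S \<subseteq> A - {0}"
    and cert: "\<And>e. \<exists>g h. c * f ^ CHAR('f) ^ e = g * x ^ CHAR('f) ^ e + h * y ^ CHAR('f) ^ e \<and>
      (\<forall>s\<in>S. \<exists>n. s ^ n * g \<in> A \<and> s ^ n * h \<in> A)"
  obtains g h where "f = x * g + y * h" "\<And>s. s \<in> S \<Longrightarrow> \<exists>n. s ^ n * g \<in> A \<and> s ^ n * h \<in> A"
proof -
  note Ac = subalgebra_closed[OF A]
  obtain e \<psi> w where \<psi>: "is_root_hom e A \<psi>" and w: "w ^ CHAR('f) ^ e = to_ac c" "\<psi> w = 1"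
    using reg mem(3,4) unfolding strongly_F_regular_def by blast
  define q where "q = CHAR('f) ^ e"
  have q: "q > 0" using prime_gt_0_nat[OF p] by (simp add: q_def)
  obtain g h where gh: "c * f ^ q = g * x ^ q + h * y ^ q"
      and den: "\<And>s. s \<in> S \<Longrightarrow> \<exists>n. s ^ n * g \<in> A \<and> s ^ n * h \<in> A"
    using cert[of e] unfolding q_def by blast
  obtain G H where GH: "G ^ q = to_ac g" "H ^ q = to_ac h"
    using nth_root_exists[OF q] by metis
  let ?F = "frobenius_roots e A"
  have roots: "r \<in> ?F \<longleftrightarrow> r ^ q \<in> to_ac ` A" for r by (simp add: frobenius_roots_def q_def)
  have w': "w \<in> ?F" unfolding roots using w(1) mem(3) by (auto simp: q_def)
  have \<psi>_in: "\<psi> r \<in> A" if "r \<in> ?F" for r using \<psi> that unfolding is_root_hom_def by blast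
  have \<psi>_add: "\<psi> (r + r') = \<psi> r + \<psi> r'" if "r \<in> ?F" "r' \<in> ?F" for r r'
    using \<psi> that unfolding is_root_hom_def by blast
  have \<psi>_mult: "\<psi> (to_ac t * r) = t * \<psi> r" if "t \<in> A" "r \<in> ?F" for t r
    using \<psi> that unfolding is_root_hom_def by blast
  have F_mult: "to_ac t * r \<in> ?F" if tr: "t \<in> A" "r \<in> ?F" for t r
  proof -
    obtain b where b: "b \<in> A" "r ^ q = to_ac b" using tr(2) unfolding roots by blast
    hence "(to_ac t * r) ^ q = to_ac (t ^ q * b)" by (simp add: power_mult_distrib)
    moreover have "t ^ q * b \<in> A" using tr(1) b(1) by (intro Ac(5,8))
    ultimately show ?thesis unfolding roots by blast
  qed
  \<comment> \<open>The root \<open>R\<close> of \<open>r\<close> need not be in the domain of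
    \<open>\<psi>\<close>, since \<open>r\<close> may lie outside \<open>A\<close>. Multiplying by
    \<open>t\<close> repairs this: the \<open>q\<close>-th power is
    \<open>t ^ (q - 1) * (t * r)\<close>.\<close>
  have F_root: "to_ac t * R \<in> ?F" if t: "t \<in> A" "t * r \<in> A" "R ^ q = to_ac r" for t r R
  proof -
    have "t ^ q = t ^ (q - 1) * t" using q by (cases q) auto
    hence "(to_ac t * R) ^ q = to_ac (t ^ (q - 1) * (t * r))"
      using t(3) by (simp add: power_mult_distrib mult_ac flip: to_ac_power to_ac_mult)
    moreover have "t ^ (q - 1) * (t * r) \<in> A" by (rule Ac(5)[OF Ac(8)[OF t(1)] t(2)])
    ultimately show ?thesis unfolding roots by blast
  qed
  have S_A: "s ^ n \<in> A" "s ^ n \<noteq> 0" if "s \<in> S" for s n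
    using that S Ac(8) by auto
  obtain s0 n0 where s0: "s0 \<in> S" "s0 ^ n0 * g \<in> A" "s0 ^ n0 * h \<in> A"
    using S den by blast
  define t where "t = s0 ^ n0"
  have t: "t \<in> A" "t \<noteq> 0" "t * g \<in> A" "t * h \<in> A" using s0 S_A by (auto simp: t_def)
  have tF: "to_ac t * G \<in> ?F" "to_ac t * H \<in> ?F" by (rule F_root[OF t(1) t(3) GH(1)] F_root[OF t(1) t(4) GH(2)])+
  \<comment> \<open>These are the values at \<open>G\<close> and \<open>H\<close> of the extension
    of \<open>\<psi>\<close> to fractions, computed with the one denominator
    \<open>t\<close>.\<close>
  define g' h' where "g' = \<psi> (to_ac t * G) / t" and "h' = \<psi> (to_ac t * H) / t"
  \<comment> \<open>Linearity gives
    \<open>s * \<psi> (to_ac t * R) = t * \<psi> (to_ac s * R)\<close>, so any other denominator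
    \<open>s\<close> of \<open>r\<close> also clears the value computed with
    \<open>t\<close>.\<close>
  have clear: "s * (\<psi> (to_ac t * R) / t) \<in> A"
    if s: "s \<in> A" "s * r \<in> A" "t * r \<in> A" "R ^ q = to_ac r" for s r R
  proof -
    note F = F_root[OF s(1,2,4)] F_root[OF t(1) s(3,4)]
    have "s * \<psi> (to_ac t * R) = \<psi> (to_ac s * (to_ac t * R))" by (rule \<psi>_mult[OF s(1) F(2), symmetric])
    also have "\<dots> = \<psi> (to_ac t * (to_ac s * R))" by (simp only: mult.left_commute)
    also have "\<dots> = t * \<psi> (to_ac s * R)" by (rule \<psi>_mult[OF t(1) F(1)])
    finally have "s * (\<psi> (to_ac t * R) / t) = \<psi> (to_ac s * R)" using t(2) by (simp add: field_simps)
    thus ?thesis using \<psi>_in[OF F(1)] by simp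
  qed
  show ?thesis
  proof (rule that)
    fix s assume s: "s \<in> S"
    obtain n where n: "s ^ n * g \<in> A" "s ^ n * h \<in> A" using den[OF s] by blast
    have "s ^ n * g' \<in> A" "s ^ n * h' \<in> A"
      unfolding g'_def h'_def
      by (rule clear[OF S_A(1)[OF s] n(1) t(3) GH(1)] clear[OF S_A(1)[OF s] n(2) t(4) GH(2)])+
    thus "\<exists>n. s ^ n * g' \<in> A \<and> s ^ n * h' \<in> A" by blast
  next
    have p': "prime CHAR('f alg_closure)" using p by simp
    \<comment> \<open>The relation is a \<open>q\<close>-th power on both sides, and Frobenius is
      injective; so its root is the linear relation \<open>eq\<close>, to which
      \<open>\<psi>\<close> applies after multiplication by \<open>t\<close>.\<close>
    have "(to_ac f * w) ^ q = to_ac (c * f ^ q)" using w(1) by (simp add: power_mult_distrib q_def)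
    also have "\<dots> = (to_ac x * G) ^ q + (to_ac y * H) ^ q"
      unfolding gh by (simp add: power_mult_distrib GH mult.commute)
    also have "\<dots> = (to_ac x * G + to_ac y * H) ^ q"
      using freshmans_dream'[OF p', of q e "to_ac x * G" "to_ac y * H"] by (simp add: q_def)
    finally have eq: "to_ac f * w = to_ac x * G + to_ac y * H"
      using frobenius_power_inject[OF p', of _ e] by (simp add: q_def)
    have "t * f = t * f * \<psi> w" using w(2) by simp
    also have "\<dots> = \<psi> (to_ac (t * f) * w)"
      by (rule \<psi>_mult[OF Ac(5)[OF t(1) mem(5)] w', symmetric])
    also have "to_ac (t * f) * w = to_ac x * (to_ac t * G) + to_ac y * (to_ac t * H)"
    proof -
      have "to_ac (t * f) * w = to_ac t * (to_ac f * w)" by simp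
      thus ?thesis unfolding eq by (simp add: algebra_simps)
    qed
    also have "\<psi> \<dots> = x * \<psi> (to_ac t * G) + y * \<psi> (to_ac t * H)"
      using tF mem by (simp add: \<psi>_add \<psi>_mult F_mult)
    finally show "f = x * g' + y * h'" using t(2) by (simp add: g'_def h'_def field_simps)
  qed
qed

section \<open>Reduction modulo \<open>x^a + y^a + z^a\<close> and non-membership in the ideal of
  \<open>x\<close> and \<open>y\<close>\<close>

text \<open>The coefficient algebra is not a field, but a monic divisor keeps the long division
  inside it.\<close>

lemma monic_division:
  assumes A: "is_subalgebra \<iota> A" and p: "p \<in> polys A"
    and m: "m \<in> polys A" "lead_coeff m = 1" "degree m > 0"
  obtains d w where "d \<in> polys A" "w \<in> polys A" "p = m * d + w" "degree w < degree m"
proof -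
  note closed = polys_closed[OF A]
  have "\<exists>d w. d \<in> polys A \<and> w \<in> polys A \<and> p = m * d + w \<and> degree w < degree m"
    using p
  proof (induction "degree p" arbitrary: p rule: less_induct)
    case less
    show ?case
    proof (cases "degree p < degree m")
      case True
      thus ?thesis using less.prems closed(1) by (intro exI[of _ 0] exI[of _ p]) auto
    next
      case False
      define u where "u = monom (lead_coeff p) (degree p - degree m)"
      have u: "u \<in> polys A" unfolding u_def using polysD[OF less.prems] by (rule closed(2))
      have "p - m * u \<in> polys A" using less.prems m(1) u by (intro closed(5,7))
      moreover have "degree (p - m * u) < degree p"
      proof (rule degree_lessI)
        show "p - m * u \<noteq> 0 \<or> degree p > 0" using False m(3) by simp
        show "\<forall>k\<ge>degree p. coeff (p - m * u) k = 0"
        proof safe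
          fix k assume k: "k \<ge> degree p"
          have mu: "coeff (m * u) k = lead_coeff p * coeff m (k - (degree p - degree m))"
            using k by (simp add: u_def coeff_monom_mult mult.commute[of m])
          show "coeff (p - m * u) k = 0"
          proof (cases "k = degree p")
            case True
            thus ?thesis using False m(2) mu by simp
          next
            case False
            thus ?thesis using k mu \<open>\<not> degree p < degree m\<close> by (simp add: coeff_eq_0)
          qed
        qed
      qed
      ultimately obtain d w where "d \<in> polys A" "w \<in> polys A" "p - m * u = m * d + w"
        "degree w < degree m" using less.hyps by blast
      moreover have "p = m * (d + u) + w" using calculation(3) by (simp add: algebra_simps)
      ultimately show ?thesis using u closed(3) by blast
    qed
  qed
  thus ?thesis using that by blast
qed

text \<open>A polynomial with nonzero constant term is prime to the variable; comparing constant
  terms strips one factor at a time.\<close>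

lemma dvd_monom_mult_cancel:
  fixes m p :: "'a::field poly"
  assumes "coeff m 0 \<noteq> 0" "m dvd monom 1 n * p"
  shows "m dvd p"
  using assms(2)
proof (induction n)
  case 0
  thus ?case by (simp add: monom_0 flip: one_pCons)
next
  case (Suc n)
  then obtain r where r: "monom 1 (Suc n) * p = m * r" by (elim dvdE)
  hence *: "pCons 0 (monom 1 n * p) = m * r" by (simp add: monom_Suc)
  hence "coeff m 0 * coeff r 0 = 0" by (metis coeff_mult_0 coeff_pCons_0)
  hence "coeff r 0 = 0" using assms(1) by simp
  then obtain r' where "r = pCons 0 r'" by (cases r) auto
  hence "monom 1 n * p = m * r'" using * by simp
  thus ?case by (intro Suc.IH) simp
qed

text \<open>The multiples of \<open>N\<close> in \<open>B\<close> form an ideal, so representability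
  modulo \<open>N\<close> by elements of \<open>A\<close> need only be checked on
  generators.\<close>

lemma is_subalgebra_add_ideal:
  assumes A: "is_subalgebra \<iota> A" and B: "is_subalgebra \<iota> B" "A \<subseteq> B" and N: "N \<in> B"
  shows "is_subalgebra \<iota> {r + N * l |r l. r \<in> A \<and> l \<in> B}" (is "is_subalgebra \<iota> ?W")
  unfolding is_subalgebra_def
proof safe
  note Ac = subalgebra_closed[OF A] and Bc = subalgebra_closed[OF B(1)]
  fix c
  have "\<iota> c = \<iota> c + N * 0" by simp
  thus "\<exists>r l. \<iota> c = r + N * l \<and> r \<in> A \<and> l \<in> B" using Ac(1) Bc(2) by blast
next
  note Ac = subalgebra_closed[OF A] and Bc = subalgebra_closed[OF B(1)]
  fix r l assume rl: "r \<in> A" "l \<in> B"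
  have "- (r + N * l) = - r + N * (- l)" by simp
  moreover have "- r \<in> A" "- l \<in> B" by (rule Ac(6)[OF rl(1)] Bc(6)[OF rl(2)])+
  ultimately show "\<exists>r' l'. - (r + N * l) = r' + N * l' \<and> r' \<in> A \<and> l' \<in> B" by blast
next
  note Ac = subalgebra_closed[OF A] and Bc = subalgebra_closed[OF B(1)]
  fix r l r' l' assume rl: "r \<in> A" "l \<in> B" "r' \<in> A" "l' \<in> B"
  have "r + N * l + (r' + N * l') = (r + r') + N * (l + l')" by (simp add: algebra_simps)
  moreover have "r + r' \<in> A" "l + l' \<in> B" by (rule Ac(4)[OF rl(1,3)] Bc(4)[OF rl(2,4)])+
  ultimately show "\<exists>s m. r + N * l + (r' + N * l') = s + N * m \<and> s \<in> A \<and> m \<in> B" by blast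
  have "(r + N * l) * (r' + N * l') = r * r' + N * (r * l' + l * r' + N * l * l')"
    by (simp add: algebra_simps)
  moreover have "r * r' \<in> A" by (rule Ac(5)[OF rl(1,3)])
  moreover have "r \<in> B" "r' \<in> B" using rl B(2) by auto
  hence "r * l' + l * r' + N * l * l' \<in> B" using rl(2,4) N by (intro Bc(4,5))
  ultimately show "\<exists>s m. (r + N * l) * (r' + N * l') = s + N * m \<and> s \<in> A \<and> m \<in> B" by blast
qed

text \<open>Clearing denominators would put \<open>y ^ n * x ^ m\<close> in the ideal of
  \<open>x ^ Suc m\<close> and \<open>y ^ Suc n\<close>. The coefficient of \<open>x ^ m\<close>
  then makes \<open>y\<close> invertible in the polynomial ring generated by
  \<open>y\<close>.\<close>

lemma monomial_not_in_monomial_ideal: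
  assumes ind: "independent x y z"
    and r: "r \<in> alg {x, y, inverse y}" "s \<in> alg {x, inverse x, y}"
  shows "1 \<noteq> x * r + y * s"
proof
  note closed = polys_closed[OF is_subalgebra_alg]
  assume eq: "1 = x * r + y * s"
  have nz: "x \<noteq> 0" "y \<noteq> 0" using independent_nonzero[OF ind] by auto
  have y: "transcendental_over (alg {}) y"
    using ind alg_mono[of "{}" "{x, z}"] transcendental_mono unfolding independent_def by blast
  have x: "transcendental_over (alg {y}) x"
    using ind alg_mono[of "{y}" "{y, z}"] transcendental_mono unfolding independent_def by blast
  have "r \<in> alg (insert (inverse y) {x, y})" "s \<in> alg (insert (inverse x) {x, y})"
    using r by (simp_all add: insert_commute)
  then obtain n m where "y ^ n * r \<in> alg {x, y}" "x ^ m * s \<in> alg {x, y}"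
    using alg_clear_denominator[of _ y "{x, y}"] alg_clear_denominator[of _ x "{x, y}"] nz
    by (metis alg_incl insertCI)
  then obtain u v where uv: "u \<in> polys (alg {y})" "y ^ n * r = poly u x"
      "v \<in> polys (alg {y})" "x ^ m * s = poly v x"
    by (metis alg_insert_poly)
  have y_in: "y ^ k \<in> alg {y}" for k by (intro alg_closed(8) alg_incl) simp
  have one_in: "1 \<in> alg {y}" by (rule alg_closed)
  have "monom (y ^ n) m = monom 1 (Suc m) * u + smult (y ^ Suc n) v"
  proof (rule transcendental_polys_eq[OF x is_subalgebra_alg])
    show "monom (y ^ n) m \<in> polys (alg {y})" using y_in by (rule closed(2))
    show "monom 1 (Suc m) * u + smult (y ^ Suc n) v \<in> polys (alg {y})"
      by (rule closed(3)[OF closed(7)[OF closed(2)[OF one_in] uv(1)] closed(6)[OF y_in uv(3)]])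
    have "y ^ n * x ^ m * 1 = x ^ Suc m * (y ^ n * r) + y ^ Suc n * (x ^ m * s)"
      unfolding eq by (simp add: algebra_simps)
    thus "poly (monom (y ^ n) m) x = poly (monom 1 (Suc m) * u + smult (y ^ Suc n) v) x"
      by (simp add: poly_monom uv(2,4))
  qed
  hence "coeff (monom (y ^ n) m) m = coeff (monom 1 (Suc m) * u + smult (y ^ Suc n) v) m" by simp
  hence "y ^ n = y ^ Suc n * coeff v m" by (simp add: coeff_monom_mult)
  hence 1: "1 = y * coeff v m" using nz by simp
  obtain k where k: "k \<in> polys (alg {})" "coeff v m = poly k y"
    using alg_insert_poly[OF polysD[OF uv(3)]] by blast
  have one_in': "1 \<in> alg {}" by (rule alg_closed)
  have "monom 1 1 * k = monom 1 0"
  proof (rule transcendental_polys_eq[OF y is_subalgebra_alg])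
    show "monom 1 1 * k \<in> polys (alg {})" by (rule closed(7)[OF closed(2)[OF one_in'] k(1)])
    show "monom 1 0 \<in> polys (alg {})" by (rule closed(2)[OF one_in'])
    show "poly (monom 1 1 * k) y = poly (monom 1 0) y" using 1 k(2) by (simp add: poly_monom)
  qed
  hence "coeff (monom 1 1 * k) 0 = coeff (monom 1 0 :: 'f poly) 0" by simp
  thus False by (simp add: coeff_monom_mult)
qed

text \<open>In \<open>h1\<close> only \<open>y\<close> is inverted, in \<open>h2\<close> only
  \<open>x\<close>. Modulo \<open>N\<close> both are polynomials in \<open>z\<close> of degree below
  \<open>a\<close>, so the relation holds exactly for these remainders, and its top coefficient
  contradicts the previous lemma.\<close>

lemma power_not_in_ideal:
  assumes ind: "independent x y z" and a: "a > 0"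
    and h1: "h1 \<in> alg {x, (y ^ a + z ^ a) / x, z, (x ^ a + y ^ a) / z, y, inverse y}"
    and h2: "h2 \<in> alg {y, (x ^ a + z ^ a) / y, z, (x ^ a + y ^ a) / z, x, inverse x}"
  shows "z ^ (a - 1) \<noteq> x * h1 + y * h2"
proof
  note closed = polys_closed[OF is_subalgebra_alg]
  assume eq: "z ^ (a - 1) = x * h1 + y * h2"
  have nz: "x \<noteq> 0" "y \<noteq> 0" "z \<noteq> 0" using independent_nonzero[OF ind] by auto
  define N where "N = x ^ a + y ^ a + z ^ a"
  define L where "L = laurent x y z"
  have L: "is_subalgebra \<iota> L" unfolding L_def laurent_def by (rule is_subalgebra_alg)
  note Lc = subalgebra_closed[OF L]
  have in_L: "x \<in> L" "y \<in> L" "z \<in> L" "inverse x \<in> L" "inverse y \<in> L" "inverse z \<in> L"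
    unfolding L_def laurent_def by (auto intro: alg_incl)
  have N_L: "N \<in> L" unfolding N_def using in_L by (intro Lc(4,8))
  \<comment> \<open>\<open>m\<close> is \<open>N\<close> as a monic polynomial in
    \<open>z\<close>.\<close>
  define m where "m = monom 1 a + monom (x ^ a + y ^ a) 0"
  have m_coeff: "coeff m i = (if i = a then 1 else if i = 0 then x ^ a + y ^ a else 0)" for i
    using a by (auto simp: m_def)
  have m_deg: "degree m = a"
  proof (rule antisym)
    show "degree m \<le> a" by (rule degree_le) (simp add: m_coeff)
    show "a \<le> degree m" by (rule le_degree) (simp add: m_coeff)
  qed
  have m_lead: "lead_coeff m = 1" by (simp add: m_deg m_coeff)
  have m_z: "poly m z = N" by (simp add: m_def N_def poly_monom add_ac)

  text \<open>
    Modulo \<open>N\<close> the exchange relations become \<open>x' = - x ^ (a - 1)\<close>, \<open>z' = - z ^ (a - 1)\<close>.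
  \<close>
  have reduce: "\<exists>w\<in>polys (alg {u, v, inverse v}). \<exists>l\<in>L. h = poly w z + N * l \<and> degree w < a"
    if uv: "{u, v} = {x, y}" and h: "h \<in> alg {u, (v ^ a + z ^ a) / u, z, (x ^ a + y ^ a) / z, v, inverse v}"
    for u v h
  proof -
    define A where "A = alg (insert z {u, v, inverse v})"
    have A: "is_subalgebra \<iota> A" unfolding A_def by (rule is_subalgebra_alg)
    have in_A: "u \<in> A" "v \<in> A" "z \<in> A" "inverse v \<in> A" unfolding A_def by (auto intro: alg_incl)
    have uv_L: "u \<in> L" "inverse u \<in> L" "v \<in> L" "inverse v \<in> L" "u \<noteq> 0"
      using uv in_L nz by (auto simp: doubleton_eq_iff)
    have AL: "A \<subseteq> L" unfolding A_def using uv_L in_L by (intro alg_minimal L) auto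
    have N_uv: "N = u ^ a + v ^ a + z ^ a" using uv by (auto simp: N_def doubleton_eq_iff)
    define W where "W = {r + N * l |r l. r \<in> A \<and> l \<in> L}"
    have W: "is_subalgebra \<iota> W" unfolding W_def by (rule is_subalgebra_add_ideal[OF A L AL N_L])
    have A_W: "r \<in> W" if "r \<in> A" for r
    proof -
      have "r = r + N * 0" by simp
      thus ?thesis unfolding W_def using that Lc(2) by blast
    qed
    have red: "(N - t ^ a) / t \<in> W" if t: "t \<in> A" "inverse t \<in> L" "t \<noteq> 0" for t
    proof -
      have "(N - t ^ a) / t = - (t ^ (a - 1)) + N * inverse t"
        using t(3) a by (cases a) (auto simp: field_simps)
      moreover have "- (t ^ (a - 1)) \<in> A" using t(1) subalgebra_closed(6,8)[OF A] by blast
      ultimately show ?thesis unfolding W_def using t(2) by blast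
    qed
    have "(v ^ a + z ^ a) / u \<in> W" using red[OF in_A(1) uv_L(2,5)] by (simp add: N_uv)
    moreover have "(x ^ a + y ^ a) / z \<in> W" using red[OF in_A(3) in_L(6) nz(3)] by (simp add: N_def)
    ultimately have "alg {u, (v ^ a + z ^ a) / u, z, (x ^ a + y ^ a) / z, v, inverse v} \<subseteq> W"
      using A_W in_A by (intro alg_minimal W) auto
    then obtain r l where rl: "r \<in> A" "l \<in> L" "h = r + N * l" using h unfolding W_def by blast
    obtain p where p: "p \<in> polys (alg {u, v, inverse v})" "r = poly p z"
      using alg_insert_poly[OF rl(1)[unfolded A_def]] by blast
    have uv_in: "u \<in> alg {u, v, inverse v}" "v \<in> alg {u, v, inverse v}" by (auto intro: alg_incl)
    have "x ^ a + y ^ a = u ^ a + v ^ a" using N_uv by (simp add: N_def)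
    also have "\<dots> \<in> alg {u, v, inverse v}" using uv_in by (intro alg_closed(4,8))
    finally have "m \<in> polys (alg {u, v, inverse v})"
      unfolding m_def by (intro closed(3,2) alg_closed(3))
    then obtain d w where dw: "d \<in> polys (alg {u, v, inverse v})" "w \<in> polys (alg {u, v, inverse v})"
        "p = m * d + w" "degree w < a"
      using monic_division[OF is_subalgebra_alg p(1) _ m_lead] a unfolding m_deg by blast
    have "poly d z \<in> A" unfolding A_def by (rule poly_in_alg_insert[OF dw(1)])
    hence "poly d z + l \<in> L" using AL rl(2) by (intro Lc(4)) auto
    moreover have "h = poly w z + N * (poly d z + l)"
      by (simp add: rl(3) p(2) dw(3) m_z algebra_simps)
    ultimately show ?thesis using dw(2,4) by blast
  qed
  obtain w1 l1 where 1: "w1 \<in> polys (alg {x, y, inverse y})" "l1 \<in> L" "h1 = poly w1 z + N * l1"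
      "degree w1 < a"
    using reduce[OF HOL.refl h1] by blast
  obtain w2 l2 where 2: "w2 \<in> polys (alg {y, x, inverse x})" "l2 \<in> L" "h2 = poly w2 z + N * l2"
      "degree w2 < a"
    using reduce[OF insert_commute h2] by blast
  define E where "E = {x, inverse x, y, inverse y}"
  \<comment> \<open>\<open>w\<close> is the relation between the remainders. Its value at
    \<open>z\<close> is \<open>N\<close> times a Laurent polynomial, so \<open>m\<close> divides it
    up to a power of the variable; having smaller degree than \<open>m\<close>, it must
    vanish.\<close>
  define w where "w = monom 1 (a - 1) - smult x w1 - smult y w2"
  have xy_E: "x \<in> alg E" "y \<in> alg E" unfolding E_def by (auto intro: alg_incl)
  have w_E: "w \<in> polys (alg E)"
  proof -
    have "w1 \<in> polys (alg E)" "w2 \<in> polys (alg E)"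
      using 1(1) 2(1) polys_mono[OF alg_mono[of "{x, y, inverse y}" E]]
        polys_mono[OF alg_mono[of "{y, x, inverse x}" E]] by (auto simp: E_def)
    thus ?thesis unfolding w_def using xy_E by (intro closed(5,6,2) alg_closed(3))
  qed
  have w_z: "poly w z = N * (x * l1 + y * l2)"
    using eq by (simp add: w_def poly_monom 1(3) 2(3) algebra_simps)
  have "x * l1 + y * l2 \<in> alg (insert (inverse z) (insert z E))"
  proof -
    have "x * l1 + y * l2 \<in> L" using in_L 1(2) 2(2) by (intro Lc(4,5))
    moreover have "{x, inverse x, y, inverse y, z, inverse z} = insert (inverse z) (insert z E)"
      unfolding E_def by blast
    ultimately show ?thesis unfolding L_def laurent_def by simp
  qed
  then obtain n where n: "z ^ n * (x * l1 + y * l2) \<in> alg (insert z E)"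
    using alg_clear_denominator[of _ z "insert z E"] nz(3) by (metis alg_incl insertI1)
  then obtain t where t: "t \<in> polys (alg E)" "z ^ n * (x * l1 + y * l2) = poly t z"
    by (rule alg_insert_poly)
  have z: "transcendental_over (alg E) z"
    using independent_transcendental_laurent[OF independent_swap(1)[OF independent_swap(2)[OF ind]]]
    unfolding E_def .
  have "m \<in> polys (alg E)" unfolding m_def using xy_E by (intro closed(3,2) alg_closed(3,4,8))
  have "monom 1 n * w = m * t"
  proof (rule transcendental_polys_eq[OF z is_subalgebra_alg])
    show "monom 1 n * w \<in> polys (alg E)" using w_E by (intro closed(7,2) alg_closed(3))
    show "m * t \<in> polys (alg E)" using \<open>m \<in> polys (alg E)\<close> t(1) by (rule closed(7))
    show "poly (monom 1 n * w) z = poly (m * t) z"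
      by (simp add: poly_monom w_z m_z flip: t(2))
  qed
  moreover have "coeff m 0 \<noteq> 0"
    using independent_power_add_nonzero[OF ind a, of a] a by (simp add: m_coeff)
  ultimately have "m dvd w" by (metis dvd_monom_mult_cancel dvd_triv_left)
  moreover have "degree w < a"
  proof (rule degree_lessI)
    show "\<forall>k\<ge>a. coeff w k = 0"
      using 1(4) 2(4) a by (auto simp: w_def coeff_eq_0)
  qed (use a in simp)
  ultimately have "w = 0" using dvd_imp_degree_le[of m w] m_deg by force
  hence "coeff w (a - 1) = 0" by simp
  hence "1 = x * coeff w1 (a - 1) + y * coeff w2 (a - 1)" by (simp add: w_def algebra_simps)
  moreover have "coeff w2 (a - 1) \<in> alg {x, inverse x, y}"
    using polysD[OF 2(1)] by (simp add: insert_commute)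
  ultimately show False
    using monomial_not_in_monomial_ideal[OF ind polysD[OF 1(1)]] by blast
qed

section \<open>Assembly for the cluster algebra of the cyclic quiver\<close>

lemma cluster_algebra_cyclic_not_strongly_F_regular:
  assumes char: "CHAR('k) > 0" and a: "a \<ge> 3" and xs: "alg_independent \<iota> {1..3} xs"
  shows "\<not> strongly_F_regular (cluster_algebra \<iota> (cyclic_seed a xs))"
proof
  let ?S = "cyclic_seed a xs"
  define A where "A = cluster_algebra \<iota> ?S"
  assume "strongly_F_regular (cluster_algebra \<iota> ?S)"
  hence reg: "strongly_F_regular A" by (simp add: A_def)
  have A: "is_subalgebra \<iota> A" unfolding A_def by (rule is_subalgebra_cluster_algebra)
  note Ac = subalgebra_closed[OF A]
  have p: "prime CHAR('f)" using char by (intro prime_CHAR_semidom) (simp add: CHAR_extension)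
  define x y z where "x = xs 1" and "y = xs 2" and "z = xs 3"
  have ind: "independent x y z"
    unfolding x_def y_def z_def by (rule alg_independent_imp_independent[OF xs])
  have nz: "x \<noteq> 0" "y \<noteq> 0" "z \<noteq> 0" using independent_nonzero[OF ind] by auto
  have AU: "A \<subseteq> upper_bound x y z a a a"
    unfolding A_def x_def y_def z_def by (rule cluster_algebra_subset_upper_bound[OF xs a])

  have var: "cluster_var T i \<in> A" if "mutation_equivalent ?S T" "i \<in> {1..rank T}" for T i
    unfolding A_def cluster_algebra_def using that by (intro hull_inc) blast
  have rank: "rank ?S = 3" "cluster_var ?S = xs" "mutable ?S = {1..3}"
    by (simp_all add: cyclic_seed_def mutable_def)
  have xyz_A: "x \<in> A" "y \<in> A" "z \<in> A"
    using var[OF mutation_equivalent.refl] unfolding rank x_def y_def z_def by simp_all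
  have mut_A: "cluster_var (mutate l ?S) l \<in> A" if "l \<in> {1..3}" for l
    using that var[OF mutation_equivalent.step[OF mutation_equivalent.refl], of l l]
    by (simp add: rank mutate_def)
  have cv: "cluster_var (mutate l ?S) l =
      (x ^ cyclic_quiver a 1 l * y ^ cyclic_quiver a 2 l * z ^ cyclic_quiver a 3 l +
       x ^ cyclic_quiver a l 1 * y ^ cyclic_quiver a l 2 * z ^ cyclic_quiver a l 3) / xs l" for l
    unfolding x_def y_def z_def
    by (simp only: mutate_def rank prod_three_vertices divide_inverse) (simp add: cyclic_seed_def)
  have x'_A: "(y ^ a + z ^ a) / x \<in> A" and y'_A: "(x ^ a + z ^ a) / y \<in> A"
      and z'_A: "(x ^ a + y ^ a) / z \<in> A"
    using mut_A[of 1] mut_A[of 2] mut_A[of 3] unfolding cv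
    by (simp_all add: cyclic_quiver_def add.commute flip: x_def y_def z_def One_nat_def)

  define M where "M = (x ^ a + y ^ a + z ^ a) / (x * y * z)"
  \<comment> \<open>The elements of \<open>S\<close> multiply \<open>M\<close> into the cluster
    algebra, and each of the four Laurent rings of the upper bound contains the inverse of at least
    one of them.\<close>
  define S where "S = {x * y, x * z, y * z}"
  have rel: "x * y * z * M = x ^ a + y ^ a + z ^ a" using nz by (simp add: M_def)
  have S_A: "S \<subseteq> A" unfolding S_def using xyz_A by (auto intro: Ac(5))
  have "s * M \<in> A" if "s \<in> S" for s
  proof -
    have pow: "t * t ^ (a - Suc 0) = t ^ a" for t :: 'f using a by (cases a) auto
    have "x * y * M = (x ^ a + y ^ a) / z + z ^ (a - 1)"
      "x * z * M = (x ^ a + z ^ a) / y + y ^ (a - 1)"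
      "y * z * M = (y ^ a + z ^ a) / x + x ^ (a - 1)"
      using nz by (simp_all add: M_def field_simps pow)
    thus ?thesis using that x'_A y'_A z'_A xyz_A unfolding S_def by (auto intro!: Ac(4,8))
  qed
  hence clear: "\<exists>n. s ^ n * g \<in> A" if "s \<in> S" "g \<in> alg {x, y, z, M}" for s g
  proof -
    have "is_subalgebra \<iota> {f. \<exists>n. s ^ n * f \<in> A}"
      using is_subalgebra_clearing[OF A] S_A that(1) by blast
    moreover have "{x, y, z, M} \<subseteq> {f. \<exists>n. s ^ n * f \<in> A}"
    proof -
      have "s ^ 0 * f \<in> A" if "f \<in> {x, y, z}" for f using that xyz_A by auto
      moreover have "s ^ 1 * M \<in> A" using \<open>\<And>s. s \<in> S \<Longrightarrow> s * M \<in> A\<close> \<open>s \<in> S\<close> by simp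
      ultimately show ?thesis by blast
    qed
    ultimately show ?thesis using alg_minimal that(2) by blast
  qed
  have clear2: "\<exists>n. s ^ n * g \<in> A \<and> s ^ n * h \<in> A"
    if s: "s \<in> S" and g: "g \<in> alg {x, y, z, M}" and h: "h \<in> alg {x, y, z, M}" for s g h
  proof -
    obtain i j where ij: "s ^ i * g \<in> A" "s ^ j * h \<in> A" using clear[OF s] g h by blast
    have sA: "s ^ n \<in> A" for n using S_A s Ac(8) by blast
    have "s ^ (i + j) * g = s ^ j * (s ^ i * g)" "s ^ (i + j) * h = s ^ i * (s ^ j * h)"
      by (simp_all add: power_add)
    thus ?thesis using Ac(5)[OF sA ij(1)] Ac(5)[OF sA ij(2)] by metis
  qed
  obtain h1 h2 where eq: "z ^ (a - 1) = x * h1 + y * h2"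
    and h: "\<And>s. s \<in> S \<Longrightarrow> \<exists>n. s ^ n * h1 \<in> A \<and> s ^ n * h2 \<in> A"
  proof (rule strongly_F_regular_tight_closure[OF A reg p xyz_A(1,2), of "z ^ a" "z ^ (a - 1)" S])
    show "z ^ a \<in> A" "z ^ (a - 1) \<in> A" using xyz_A by (auto intro: Ac(8))
    show "z ^ a \<noteq> 0" using nz by simp
    show "S \<noteq> {}" "S \<subseteq> A - {0}" using S_A nz by (auto simp: S_def)
    fix e
    have "CHAR('f) ^ e > 0" using prime_gt_0_nat[OF p] by simp
    then obtain g h where "g \<in> alg {x, y, z, M}" "h \<in> alg {x, y, z, M}"
      "z ^ a * (z ^ (a - 1)) ^ CHAR('f) ^ e = g * x ^ CHAR('f) ^ e + h * y ^ CHAR('f) ^ e"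
      by (rule tight_closure_certificate[OF a rel])
    thus "\<exists>g h. z ^ a * (z ^ (a - 1)) ^ CHAR('f) ^ e = g * x ^ CHAR('f) ^ e + h * y ^ CHAR('f) ^ e \<and>
        (\<forall>s\<in>S. \<exists>n. s ^ n * g \<in> A \<and> s ^ n * h \<in> A)"
      using clear2 by blast
  qed blast

  have invert: "g \<in> laurent u v w" if s: "s ^ n * g \<in> A" "A \<subseteq> laurent u v w"
    "s \<noteq> 0" "inverse s \<in> laurent u v w" for g s n u v w
  proof -
    have "g = inverse s ^ n * (s ^ n * g)" using s(3) by (simp flip: mult.assoc power_mult_distrib)
    also have "\<dots> \<in> laurent u v w"
      unfolding laurent_def
      by (rule alg_closed(5)[OF alg_closed(8)[OF s(4)[unfolded laurent_def]]
            subsetD[OF s(2)[unfolded laurent_def] s(1)]])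
    finally show ?thesis .
  qed
  have inv_mult: "inverse (s * t) \<in> laurent u v w"
    if "s \<in> {u, v, w}" "t \<in> {u, v, w}" for s t u v w :: 'f
  proof -
    have "inverse s \<in> laurent u v w" "inverse t \<in> laurent u v w"
      using that unfolding laurent_def by (auto intro: alg_incl)
    thus ?thesis unfolding inverse_mult_distrib laurent_def by (rule alg_closed(5))
  qed
  have h_in: "h \<in> laurent x y z \<and> h \<in> laurent ((y ^ a + z ^ a) / x) y z \<and>
      h \<in> laurent x ((x ^ a + z ^ a) / y) z \<and> h \<in> laurent x y ((x ^ a + y ^ a) / z)"
    if h: "\<And>s. s \<in> S \<Longrightarrow> \<exists>n. s ^ n * h \<in> A" for h
  proof -
    obtain i j k where ijk: "(x * y) ^ i * h \<in> A" "(x * z) ^ j * h \<in> A" "(y * z) ^ k * h \<in> A"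
      using h[of "x * y"] h[of "x * z"] h[of "y * z"] by (auto simp: S_def)
    have sub: "A \<subseteq> laurent x y z" "A \<subseteq> laurent ((y ^ a + z ^ a) / x) y z"
      "A \<subseteq> laurent x ((x ^ a + z ^ a) / y) z" "A \<subseteq> laurent x y ((x ^ a + y ^ a) / z)"
      using AU unfolding upper_bound_def by auto
    have nz': "x * y \<noteq> 0" "x * z \<noteq> 0" "y * z \<noteq> 0" using nz by auto
    show ?thesis
      using invert[OF ijk(1) sub(1) nz'(1) inv_mult] invert[OF ijk(3) sub(2) nz'(3) inv_mult]
        invert[OF ijk(2) sub(3) nz'(2) inv_mult] invert[OF ijk(1) sub(4) nz'(1) inv_mult]
      by simp
  qed
  have h1: "h1 \<in> laurent x y z" "h1 \<in> laurent ((y ^ a + z ^ a) / x) y z"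
      "h1 \<in> laurent x y ((x ^ a + y ^ a) / z)"
    and h2: "h2 \<in> laurent x y z" "h2 \<in> laurent x ((x ^ a + z ^ a) / y) z"
      "h2 \<in> laurent x y ((x ^ a + y ^ a) / z)"
    using h_in[of h1] h_in[of h2] h by blast+
  have a0: "a > 0" using a by simp
  \<comment> \<open>For \<open>h1\<close> the exchange pairs at \<open>x\<close> and
    \<open>z\<close> are used and only \<open>y\<close> stays inverted; for \<open>h2\<close> those
    at \<open>y\<close> and \<open>z\<close>, with \<open>x\<close> inverted. This is the shape that
    \<open>power_not_in_ideal\<close> takes.\<close>
  have "h1 \<in> alg {x, (z ^ a + y ^ a) / x, z, (x ^ a + y ^ a) / z, y, inverse y}"
  proof (rule laurent_exchange[OF independent_swap(2)[OF ind] a0])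
    show "h1 \<in> laurent x z y" using h1(1) by (subst laurent_swap(2))
    show "h1 \<in> laurent ((z ^ a + y ^ a) / x) z y"
      using h1(2) by (subst laurent_swap(2), subst add.commute)
    show "h1 \<in> laurent x ((x ^ a + y ^ a) / z) y" using h1(3) by (subst laurent_swap(2))
  qed
  moreover have "h2 \<in> alg {y, (z ^ a + x ^ a) / y, z, (y ^ a + x ^ a) / z, x, inverse x}"
  proof (rule laurent_exchange[OF independent_swap(2)[OF independent_swap(1)[OF ind]] a0])
    have rot: "laurent u v w = laurent v w u" for u v w
      by (rule trans[OF laurent_swap(1)[of u v w] laurent_swap(2)[of v u w]])
    show "h2 \<in> laurent y z x" using h2(1) unfolding rot[of x] .
    show "h2 \<in> laurent ((z ^ a + x ^ a) / y) z x"
      using h2(2) unfolding rot[of x] add.commute[of "x ^ a"] .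
    show "h2 \<in> laurent y ((y ^ a + x ^ a) / z) x"
      using h2(3) unfolding rot[of x] add.commute[of "x ^ a"] .
  qed
  ultimately show False
    using power_not_in_ideal[OF ind a0, of h1 h2] eq by (simp add: add.commute)
qed

end

theorem corollary5p5:
  fixes \<iota> :: "'k::field \<Rightarrow> 'f::field"
    and x :: "nat \<Rightarrow> 'f"
    and a p :: nat
  assumes "CHAR('k) = p" and "p > 0"
    and "F_finite TYPE('k)"
    and "a \<ge> 3"
    and "is_field_hom \<iota>"
    and "is_seed \<iota> (cyclic_seed a x)"
  shows "\<not> strongly_F_regular (cluster_algebra \<iota> (cyclic_seed a x))"
proof -
  interpret field_extension \<iota> by standard fact
  have "alg_independent \<iota> {1..3} x"
    using assms by (simp add: is_seed_cyclic_seed_iff is_cluster_def)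
  thus ?thesis using assms by (intro cluster_algebra_cyclic_not_strongly_F_regular) auto
qed

end
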